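(* Let $n\in\mathbb{N}_0=\{0,1,2,\dots\}$. Let $\mathcal{G}$ be a complex Hilbert space, let $\mathcal{H}$ and $\mathcal{H}_k$, $k\in\mathbb{N}$, be closed subspaces of $\mathcal{G}$, and let $T$ and $T_k$, $k\in\mathbb{N}$, be closed, densely defined operators acting in the Hilbert spaces $\mathcal{H}$ and $\mathcal{H}_k$, respectively, such that $\bigcap_{k\in\mathbb{N}}\rho(T_k)\cap\rho(T)\neq\emptyset$. Let $K\subset\mathbb{C}$ be compact and $\varepsilon>0$. Suppose that i) $\overline{\sigma_{n,\varepsilon}(T)}\cap K=\overline{\sigma_{n,\varepsilon}(T)\cap K}\neq\emptyset$; ii) the function $\lambda\mapsto\|(T-\lambda)^{-2^n}\|$ is non-constant on every non-empty open subset of $\rho(T)$; iii) $T_k$ converges to $T$ in the generalised norm resolvent sense. Then $$d_{\rm H}\left(\overline{\sigma_{n,\varepsilon}(T_k)}\cap K,\ \overline{\sigma_{n,\varepsilon}(T)}\cap K\right)\longrightarrow 0,\qquad k\to\infty.$$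
   Context: For $n\in\mathbb{N}_0$ and $\varepsilon>0$, the $(n,\varepsilon)$-pseudospectrum of a closed operator $T$ is $\sigma_{n,\varepsilon}(T):=\{z\in\mathbb{C}: \|(T-z)^{-2^n}\|^{1/2^n}>1/\varepsilon\}$, with the convention $\|(T-z)^{-2^n}\|=\infty$ for $z\in\sigma(T)$; $\rho(T)$ is the resolvent set and $\sigma(T)$ the spectrum. Let $P$ and $P_k$ denote the orthogonal projections of $\mathcal{G}$ onto $\mathcal{H}$ and $\mathcal{H}_k$, respectively. $T_k$ converges to $T$ in the generalised norm resolvent sense if there exists $\lambda_0\in\bigcap_{k\in\mathbb{N}}\rho(T_k)\cap\rho(T)$ such that $\|(T_k-\lambda_0)^{-1}P_k-(T-\lambda_0)^{-1}P\|\to0$ as $k\to\infty$ (operator norm of bounded operators on $\mathcal{G}$). For non-empty compact sets $K_1,K_2\subset\mathbb{C}$ the Hausdorff distance is $d_{\rm H}(K_1,K_2):=\max\{\sup_{z\in K_1}\mathrm{dist}(z,K_2),\ \sup_{z\in K_2}\mathrm{dist}(z,K_1)\}$, where $\mathrm{dist}(z,K_j):=\inf_{w\in K_j}|z-w|$. The convergence of the Hausdorff distances includes the assertion that the sets $\overline{\sigma_{n,\varepsilon}(T_k)}\cap K$ are non-empty for all sufficiently large $k$. *)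

theory Defs
  imports "HOL-Analysis.Analysis"
begin

section \<open>Complex Hilbert spaces\<close>

text \<open>
  A complex Hilbert space is a complete real inner product space (with real part of the complex
  inner product as real inner product, hence the same norm) carrying a complex scalar
  multiplication that extends the real one.  The inner product is linear in the first argument.
  Positive definiteness and norm x = sqrt (Re (cinner x x)) are inherited from \<^class>\<open>real_inner\<close>.
\<close>

class complex_hilbert_space = real_inner + complete_space +
  fixes scaleC :: "complex \<Rightarrow> 'a \<Rightarrow> 'a" (infixr \<open>*\<^sub>C\<close> 75)
    and cinner :: "'a \<Rightarrow> 'a \<Rightarrow> complex"
  assumes scaleC_add_right: "a *\<^sub>C (x + y) = a *\<^sub>C x + a *\<^sub>C y"
    and scaleC_add_left: "(a + b) *\<^sub>C x = a *\<^sub>C x + b *\<^sub>C x"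
    and scaleC_scaleC: "a *\<^sub>C (b *\<^sub>C x) = (a * b) *\<^sub>C x"
    and scaleC_of_real: "complex_of_real r *\<^sub>C x = r *\<^sub>R x"
    and cinner_commute: "cinner x y = cnj (cinner y x)"
    and cinner_add_left: "cinner (x + y) z = cinner x z + cinner y z"
    and cinner_scaleC_left: "cinner (a *\<^sub>C x) y = a * cinner x y"
    and Re_cinner: "Re (cinner x y) = inner x y"
begin

subclass banach ..

end

global_interpretation complex_vector:
  vector_space "scaleC :: complex \<Rightarrow> 'a \<Rightarrow> 'a::complex_hilbert_space"
proof
  show "1 *\<^sub>C x = x" for x :: 'a
    using scaleC_of_real[of 1 x] by simp
qed (rule scaleC_add_right scaleC_add_left scaleC_scaleC)+

lemma cinner_self: "cinner x x = complex_of_real ((norm x)\<^sup>2)"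
proof (rule complex_eqI)
  have "Im (cinner x x) = - Im (cinner x x)"
    using arg_cong[OF cinner_commute[of x x], of Im] by simp
  then show "Im (cinner x x) = Im (complex_of_real ((norm x)\<^sup>2))" by simp
qed (simp add: Re_cinner power2_norm_eq_inner)

instantiation complex :: complex_hilbert_space
begin

definition scaleC_complex :: "complex \<Rightarrow> complex \<Rightarrow> complex" where
  "scaleC_complex a x = a * x"

definition cinner_complex :: "complex \<Rightarrow> complex \<Rightarrow> complex" where
  "cinner_complex x y = x * cnj y"

instance
  by standard (auto simp: scaleC_complex_def cinner_complex_def algebra_simps
      scaleR_conv_of_real inner_complex_def)

end

definition closed_csubspace :: "'a::complex_hilbert_space set \<Rightarrow> bool" where
  "closed_csubspace H \<longleftrightarrow> complex_vector.subspace H \<and> closed H"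

definition orth_proj :: "'a::complex_hilbert_space set \<Rightarrow> 'a \<Rightarrow> 'a" where
  "orth_proj H x = (THE p. p \<in> H \<and> (\<forall>y\<in>H. cinner (x - p) y = 0))"

text \<open>
  Operator norm of a map acting in the subspace H; for H = UNIV this is \<^const>\<open>onorm\<close>.
  It is only meaningful for maps that are bounded on H.
\<close>

definition onorm_on :: "'a::real_normed_vector set \<Rightarrow> ('a \<Rightarrow> 'a) \<Rightarrow> real" where
  "onorm_on H f = (SUP x\<in>H. norm (f x) / norm x)"

section \<open>Unbounded operators\<close>

text \<open>The values of \<open>op_app\<close> outside \<open>op_dom\<close> are irrelevant.\<close>

record 'a unbounded_op =
  op_dom :: "'a set"
  op_app :: "'a \<Rightarrow> 'a"

definition linear_operator_in ::
    "'a::complex_hilbert_space set \<Rightarrow> 'a unbounded_op \<Rightarrow> bool" where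
  "linear_operator_in H T \<longleftrightarrow>
     complex_vector.subspace (op_dom T) \<and> op_dom T \<subseteq> H \<and> op_app T ` op_dom T \<subseteq> H \<and>
     (\<forall>x\<in>op_dom T. \<forall>y\<in>op_dom T. op_app T (x + y) = op_app T x + op_app T y) \<and>
     (\<forall>a. \<forall>x\<in>op_dom T. op_app T (a *\<^sub>C x) = a *\<^sub>C op_app T x)"

definition densely_defined_in ::
    "'a::complex_hilbert_space set \<Rightarrow> 'a unbounded_op \<Rightarrow> bool" where
  "densely_defined_in H T \<longleftrightarrow> H \<subseteq> closure (op_dom T)"

text \<open>Closedness of the graph in the whole space is the same as in H when H is closed.\<close>

definition closed_operator :: "'a::complex_hilbert_space unbounded_op \<Rightarrow> bool" where
  "closed_operator T \<longleftrightarrow> closed ((\<lambda>x. (x, op_app T x)) ` op_dom T)"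

definition shifted :: "'a::complex_hilbert_space unbounded_op \<Rightarrow> complex \<Rightarrow> 'a \<Rightarrow> 'a" where
  "shifted T z x = op_app T x - z *\<^sub>C x"

definition resolvent :: "'a::complex_hilbert_space unbounded_op \<Rightarrow> complex \<Rightarrow> 'a \<Rightarrow> 'a" where
  "resolvent T z = inv_into (op_dom T) (shifted T z)"

text \<open>
  Resolvent set and spectrum of T as an operator in H.  Values of the resolvent outside H are
  irrelevant.
\<close>

definition resolvent_set ::
    "'a::complex_hilbert_space set \<Rightarrow> 'a unbounded_op \<Rightarrow> complex set" where
  "resolvent_set H T =
     {z. bij_betw (shifted T z) (op_dom T) H \<and>
         (\<exists>C. \<forall>y\<in>H. norm (resolvent T z y) \<le> C * norm y)}"

definition spectrum ::
    "'a::complex_hilbert_space set \<Rightarrow> 'a unbounded_op \<Rightarrow> complex set" where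
  "spectrum H T = - resolvent_set H T"

definition resolvent_power_norm ::
    "nat \<Rightarrow> 'a::complex_hilbert_space set \<Rightarrow> 'a unbounded_op \<Rightarrow> complex \<Rightarrow> real" where
  "resolvent_power_norm n H T z = onorm_on H (resolvent T z ^^ (2 ^ n))"

text \<open>
  The union with the spectrum implements the convention that the norm of the resolvent power is
  infinite there.
\<close>

definition pseudospectrum ::
    "nat \<Rightarrow> real \<Rightarrow> 'a::complex_hilbert_space set \<Rightarrow> 'a unbounded_op \<Rightarrow> complex set" where
  "pseudospectrum n \<epsilon> H T =
     spectrum H T \<union>
     {z \<in> resolvent_set H T. resolvent_power_norm n H T z powr (1 / 2 ^ n) > 1 / \<epsilon>}"

definition gen_norm_resolvent_conv ::
    "(nat \<Rightarrow> 'a::complex_hilbert_space set) \<Rightarrow> (nat \<Rightarrow> 'a unbounded_op) \<Rightarrow>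
     'a set \<Rightarrow> 'a unbounded_op \<Rightarrow> bool" where
  "gen_norm_resolvent_conv Hk Tk H T \<longleftrightarrow>
     (\<exists>\<mu> \<in> (\<Inter>k. resolvent_set (Hk k) (Tk k)) \<inter> resolvent_set H T.
       (\<lambda>k. onorm (\<lambda>x. resolvent (Tk k) \<mu> (orth_proj (Hk k) x) - resolvent T \<mu> (orth_proj H x)))
         \<longlonglongrightarrow> 0)"

section \<open>Hausdorff distance\<close>

text \<open>Only meaningful for non-empty compact arguments.\<close>

definition hausdorff_dist :: "complex set \<Rightarrow> complex set \<Rightarrow> real" where
  "hausdorff_dist K1 K2 = max (SUP z\<in>K1. infdist z K2) (SUP z\<in>K2. infdist z K1)"

end

theory Submission
  imports Defs "HOL-Complex_Analysis.Riemann_Mapping"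
begin

text \<open>
  Extending resolvents by 0 on the orthogonal complements puts all of them into the bounded
  operators on the whole space. With \<open>A = (T - \<mu>)\<inverse> P\<close>, a point \<open>z\<close> lies in the resolvent set of \<open>T\<close>
  iff \<open>1 - (z - \<mu>) A\<close> is invertible, and then \<open>(T - z)\<inverse> P = A (1 - (z - \<mu>) A)\<inverse>\<close>. Hence \<open>A\<^sub>k \<rightarrow> A\<close>
  and \<open>z\<^sub>k \<rightarrow> z \<in> \<rho>(T)\<close> imply \<open>z\<^sub>k \<in> \<rho>(T\<^sub>k)\<close> eventually and convergence of the resolvents at \<open>z\<^sub>k\<close>.

  Every point of the pseudospectrum of \<open>T\<close> eventually lies in that of \<open>T\<^sub>k\<close>: off the spectrum by
  convergence of the resolvent powers, and on the spectrum because a bound on the \<open>2\<^sup>n\<close>-th powers of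
  the resolvents of \<open>T\<^sub>k\<close> at \<open>z\<close> would bound the resolvents themselves, and so put \<open>z\<close> into the
  resolvent set of \<open>T\<close>. Conversely, let \<open>z\<close> be a limit of points of the pseudospectra of \<open>T\<^sub>k\<close>. If
  \<open>z\<close> had a neighbourhood disjoint from the pseudospectrum of \<open>T\<close>, then the norm of the resolvent
  power would attain its maximum over this neighbourhood at \<open>z\<close>, hence be constant there by the
  maximum principle, which is excluded. A compactness argument turns both facts into Hausdorff
  convergence.
\<close>

section \<open>Complex Hilbert spaces and orthogonal projections\<close>

text \<open>The norm comes from the real inner product, so its behaviour under complex scalars has
  to be derived from the sesquilinearity of \<open>cinner\<close>.\<close>

lemma norm_scaleC: "norm (a *\<^sub>C x) = cmod a * norm x"
  for x :: "'a::complex_hilbert_space"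
proof -
  have "complex_of_real ((norm (a *\<^sub>C x))\<^sup>2) = a * (cnj a * cinner x x)"
    by (metis cinner_commute cinner_scaleC_left cinner_self complex_cnj_mult)
  also have "\<dots> = complex_of_real ((cmod a * norm x)\<^sup>2)"
    using complex_norm_square[of a] by (simp add: cinner_self power_mult_distrib)
  finally show ?thesis
    by (metis mult_nonneg_nonneg norm_ge_zero of_real_eq_iff power2_eq_imp_eq)
qed

lemma scaleC_scaleR: "a *\<^sub>C (r *\<^sub>R x) = r *\<^sub>R (a *\<^sub>C x)"
  and scaleR_scaleC: "(r *\<^sub>R a) *\<^sub>C x = r *\<^sub>R (a *\<^sub>C x)"
  for x :: "'a::complex_hilbert_space"
  by (metis scaleC_of_real scaleC_scaleC mult.commute)
    (metis scaleC_of_real scaleC_scaleC scaleR_conv_of_real)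

lemma bounded_bilinear_scaleC:
  "bounded_bilinear (scaleC :: complex \<Rightarrow> 'a \<Rightarrow> 'a::complex_hilbert_space)"
  by (rule bounded_bilinear.intro)
    (auto simp: scaleC_add_left scaleC_add_right scaleC_scaleR scaleR_scaleC norm_scaleC
      intro!: exI[of _ 1])

interpretation scaleC: bounded_bilinear
  "scaleC :: complex \<Rightarrow> 'a \<Rightarrow> 'a::complex_hilbert_space"
  by (rule bounded_bilinear_scaleC)

lemmas scaleC_algebra =
  scaleC.add_left scaleC.add_right scaleC.diff_left scaleC.diff_right
  scaleC.minus_left scaleC.minus_right scaleC.zero_left scaleC.zero_right scaleC_scaleC

text \<open>Bounded operators of this type are only real linear; a complex multiple
  \<open>c A\<close> is written as the composition of this operator with \<open>A\<close>. Complex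
  homogeneity of an operator is therefore always a separate fact.\<close>

lift_definition blinfun_scaleC :: "complex \<Rightarrow> 'a \<Rightarrow>\<^sub>L 'a::complex_hilbert_space"
  is "\<lambda>a x. a *\<^sub>C x"
  by (rule scaleC.bounded_linear_right)

declare blinfun_scaleC.rep_eq [simp]

text \<open>Only an inequality, because on the zero space every operator has norm 0.\<close>

lemma norm_blinfun_scaleC_le: "norm (blinfun_scaleC a) \<le> cmod a"
  by (rule norm_blinfun_bound) (auto simp: norm_scaleC)

lemma norm_blinfun_scaleC_compose_le: "norm (blinfun_scaleC a o\<^sub>L X) \<le> cmod a * norm X"
  by (rule order_trans[OF norm_blinfun_compose mult_right_mono[OF norm_blinfun_scaleC_le norm_ge_zero]])

lemma bounded_linear_blinfun_scaleC: "bounded_linear blinfun_scaleC"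
  by (rule bounded_linear_intro[where K = 1])
    (auto intro!: blinfun_eqI simp: scaleC_algebra scaleR_scaleC blinfun.bilinear_simps
      norm_blinfun_scaleC_le)

lemma scaleC_cinner_right: "cinner x (a *\<^sub>C y) = cnj a * cinner x y"
  by (metis cinner_commute cinner_scaleC_left complex_cnj_mult)

lemma cmod_cinner_le: "cmod (cinner x y) \<le> norm x * norm y"
  for x y :: "'a::complex_hilbert_space"
proof (cases "cinner x y = 0")
  case False
  \<comment> \<open>This phase rotates \<open>cinner x y\<close> onto the nonnegative real axis,
    where the real Cauchy-Schwarz inequality applies.\<close>
  define u where "u = cnj (sgn (cinner x y))"
  have "complex_of_real (cmod (cinner x y)) = u * cinner x y"
    using False
    using complex_norm_square[of "cinner x y"]
    by (simp add: u_def sgn_div_norm scaleR_conv_of_real field_simps power2_eq_square)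
  then have "cmod (cinner x y) = inner (u *\<^sub>C x) y"
    by (metis Re_cinner Re_complex_of_real cinner_scaleC_left)
  also have "\<dots> \<le> norm (u *\<^sub>C x) * norm y"
    by (rule norm_cauchy_schwarz)
  finally show ?thesis
    using False by (simp add: norm_scaleC u_def norm_sgn)
qed simp

lemma bounded_linear_cinner_left: "bounded_linear (\<lambda>x. cinner x y)"
  for y :: "'a::complex_hilbert_space"
proof (rule bounded_linear_intro[where K = "norm y"])
  show "cinner (r *\<^sub>R x) y = r *\<^sub>R cinner x y" for r and x :: 'a
    by (metis cinner_scaleC_left scaleC_of_real scaleR_conv_of_real)
qed (auto simp: cinner_add_left cmod_cinner_le)

text \<open>A minimising sequence for the distance from \<open>x\<close> to \<open>H\<close> is
  Cauchy by the parallelogram law. Its limit attains the distance, and minimality along the lines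
  through it gives orthogonality. For uniqueness, the difference of two such points is orthogonal to
  itself.\<close>

lemma exists_orthogonal_projection:
  fixes H :: "'a::complex_hilbert_space set"
  assumes "closed_csubspace H"
  shows "\<exists>!p. p \<in> H \<and> (\<forall>y\<in>H. cinner (x - p) y = 0)"
proof -
  have sub: "complex_vector.subspace H" and "closed H"
    using assms by (auto simp: closed_csubspace_def)
  have add: "a + b \<in> H" and diff: "a - b \<in> H" and scale: "c *\<^sub>C a \<in> H"
    if "a \<in> H" "b \<in> H" for a b c
    using that sub complex_vector.subspace_add complex_vector.subspace_diff
      complex_vector.subspace_scale by blast+
  have scaleR: "r *\<^sub>R a \<in> H" if "a \<in> H" for a r
    using scale[OF that that, of "complex_of_real r"] by (simp add: scaleC_of_real)
  have "0 \<in> H"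
    using sub complex_vector.subspace_0 by blast
  then have ne: "H \<noteq> {}" by auto
  define d where "d = infdist x H"
  have d0: "d \<ge> 0" by (simp add: d_def infdist_nonneg)
  have dle: "d \<le> norm (x - a)" if "a \<in> H" for a
    using infdist_le[OF that, of x] by (simp add: d_def dist_norm)
  have "\<exists>a\<in>H. norm (x - a) < d + 1 / Suc j" for j
    using cInf_lessD[of "dist x ` H" "d + 1 / Suc j"] ne
    by (auto simp: d_def infdist_notempty dist_norm)
  then obtain a where aH: "\<And>j. a j \<in> H" and a: "\<And>j. norm (x - a j) < d + 1 / Suc j"
    by metis
  have "(\<lambda>j. norm (x - a j)) \<longlonglongrightarrow> d"
  proof (rule tendsto_sandwich[OF _ _ tendsto_const])
    show "(\<lambda>j. d + 1 / Suc j) \<longlonglongrightarrow> d"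
      using tendsto_add[OF tendsto_const LIMSEQ_Suc[OF lim_1_over_n]] by simp
  qed (use a aH dle in \<open>auto intro!: always_eventually less_imp_le simp del: of_nat_Suc\<close>)
  then have lim: "(\<lambda>j. (norm (x - a j))\<^sup>2) \<longlonglongrightarrow> d\<^sup>2"
    by (rule tendsto_power)
  \<comment> \<open>The midpoint of \<open>a i\<close> and \<open>a j\<close> lies in
    \<open>H\<close> and so has distance at least \<open>d\<close> from \<open>x\<close>; the
    parallelogram law turns this into a bound for \<open>a i - a j\<close>.\<close>
  have par: "(norm (a i - a j))\<^sup>2 \<le> 2 * ((norm (x - a i))\<^sup>2 - d\<^sup>2) + 2 * ((norm (x - a j))\<^sup>2 - d\<^sup>2)"
    for i j
  proof -
    have "(1/2) *\<^sub>R (a i + a j) \<in> H" using aH add scaleR by blast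
    from power_mono[OF dle[OF this] d0, of 2]
    have "4 * d\<^sup>2 \<le> (2 * norm (x - (1/2) *\<^sub>R (a i + a j)))\<^sup>2"
      by (simp add: power_mult_distrib)
    also have "2 * norm (x - (1/2) *\<^sub>R (a i + a j)) = norm ((x - a i) + (x - a j))"
      using norm_scaleR[of 2 "x - (1/2) *\<^sub>R (a i + a j)"]
      by (simp add: algebra_simps scaleR_2 del: norm_scaleR)
    finally show ?thesis
      unfolding power2_norm_eq_inner by (simp add: algebra_simps inner_commute)
  qed
  have "Cauchy a"
  proof (rule metric_CauchyI)
    fix e :: real assume "e > 0"
    then have "e\<^sup>2 / 4 > 0" by simp
    with lim have "\<forall>\<^sub>F j in sequentially. dist ((norm (x - a j))\<^sup>2) (d\<^sup>2) < e\<^sup>2 / 4"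
      by (rule tendstoD)
    then obtain N where N: "\<And>j. j \<ge> N \<Longrightarrow> (norm (x - a j))\<^sup>2 - d\<^sup>2 < e\<^sup>2 / 4"
      unfolding eventually_sequentially dist_real_def by (meson abs_ge_self le_less_trans)
    have "dist (a i) (a j) < e" if "i \<ge> N" "j \<ge> N" for i j
      using par[of i j] N[OF that(1)] N[OF that(2)] \<open>e > 0\<close>
      by (intro power2_less_imp_less[of _ e]) (auto simp: dist_norm)
    then show "\<exists>N. \<forall>i\<ge>N. \<forall>j\<ge>N. dist (a i) (a j) < e" by blast
  qed
  then obtain p where p: "a \<longlonglongrightarrow> p"
    using Cauchy_convergent convergent_def by blast
  have pH: "p \<in> H"
    using closed_sequentially[OF \<open>closed H\<close> _ p] aH by blast
  have "(\<lambda>j. (norm (x - a j))\<^sup>2) \<longlonglongrightarrow> (norm (x - p))\<^sup>2"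
    by (intro tendsto_intros p)
  with lim have pd: "norm (x - p) = d"
    using LIMSEQ_unique d0 by (metis norm_ge_zero power2_eq_iff_nonneg)
  have inner0: "inner (x - p) y = 0" if "y \<in> H" for y
  proof (cases "y = 0")
    case False
    \<comment> \<open>The minimiser of the quadratic polynomial expanded below; any nonzero inner
      product would push the distance below \<open>d\<close>.\<close>
    define t where "t = inner (x - p) y / (norm y)\<^sup>2"
    have "d\<^sup>2 \<le> (norm (x - (p + t *\<^sub>R y)))\<^sup>2"
      using power_mono[OF dle[OF add[OF pH scaleR[OF that]]] d0] by blast
    also have "\<dots> = (norm (x - p))\<^sup>2 - 2 * t * inner (x - p) y + t\<^sup>2 * (norm y)\<^sup>2"
      unfolding power2_norm_eq_inner by (simp add: algebra_simps inner_commute power2_eq_square)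
    also have "\<dots> = d\<^sup>2 - (inner (x - p) y)\<^sup>2 / (norm y)\<^sup>2"
      using False by (simp add: t_def pd field_simps power2_eq_square)
    finally show ?thesis
      using False by (simp add: divide_le_0_iff)
  qed simp
  have "cinner (x - p) y = 0" if "y \<in> H" for y
  proof (rule complex_eqI)
    \<comment> \<open>Testing against \<open>\<i> *\<^sub>C y\<close>, again an element of
      \<open>H\<close>, turns the imaginary part into a real part.\<close>
    have "Re (cinner (x - p) (\<i> *\<^sub>C y)) = 0"
      using inner0[OF scale[OF that that]] by (simp add: Re_cinner)
    then show "Im (cinner (x - p) y) = Im 0"
      by (simp add: scaleC_cinner_right)
  qed (use inner0[OF that] in \<open>simp add: Re_cinner\<close>)
  moreover have "q = p" if "q \<in> H" "\<forall>y\<in>H. cinner (x - q) y = 0" for q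
  proof -
    have "inner (x - q) (q - p) = 0"
      using that(2) diff[OF that(1) pH] by (metis Re_cinner zero_complex.simps(1))
    moreover have "inner (x - p) (q - p) = 0"
      using inner0 diff[OF that(1) pH] by blast
    ultimately have "inner (q - p) (q - p) = 0"
      by (simp add: algebra_simps)
    then show ?thesis by simp
  qed
  ultimately show ?thesis using pH by blast
qed

context
  fixes H :: "'a::complex_hilbert_space set"
  assumes H: "closed_csubspace H"
begin

lemma orth_proj_in: "orth_proj H x \<in> H"
  and orth_proj_orthogonal: "y \<in> H \<Longrightarrow> cinner (x - orth_proj H x) y = 0"
  using theI'[OF exists_orthogonal_projection[OF H, of x]] by (auto simp: orth_proj_def)

lemma orth_proj_eqI:
  assumes "p \<in> H" "\<And>y. y \<in> H \<Longrightarrow> cinner (x - p) y = 0"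
  shows "orth_proj H x = p"
  using exists_orthogonal_projection[OF H, of x] assms orth_proj_in orth_proj_orthogonal by blast

lemma orth_proj_of_mem: "x \<in> H \<Longrightarrow> orth_proj H x = x"
  by (intro orth_proj_eqI)
    (auto simp: linear_simps(3)[OF bounded_linear_cinner_left])

lemma norm_orth_proj_le: "norm (orth_proj H x) \<le> norm x"
proof -
  have "inner (x - orth_proj H x) (orth_proj H x) = 0"
    by (metis orth_proj_in orth_proj_orthogonal Re_cinner zero_complex.simps(1))
  then have "inner (orth_proj H x) (orth_proj H x) = inner x (orth_proj H x)"
    by (simp add: algebra_simps)
  then have "norm (orth_proj H x) * norm (orth_proj H x) \<le> norm x * norm (orth_proj H x)"
    by (metis norm_cauchy_schwarz power2_eq_square power2_norm_eq_inner)
  then show ?thesis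
    by (metis mult_le_cancel_right norm_ge_zero norm_not_less_zero not_le order_trans)
qed

lemma orth_proj_add: "orth_proj H (x + y) = orth_proj H x + orth_proj H y"
proof (rule orth_proj_eqI)
  show "orth_proj H x + orth_proj H y \<in> H"
    using H orth_proj_in[of x] orth_proj_in[of y]
    by (auto simp: closed_csubspace_def intro!: complex_vector.subspace_add)
  show "cinner (x + y - (orth_proj H x + orth_proj H y)) z = 0" if "z \<in> H" for z
    using orth_proj_orthogonal[OF that, of x] orth_proj_orthogonal[OF that, of y]
    by (metis (no_types, lifting) add_diff_add add.right_neutral cinner_add_left)
qed

lemma orth_proj_scaleC: "orth_proj H (a *\<^sub>C x) = a *\<^sub>C orth_proj H x"
proof (rule orth_proj_eqI)
  show "a *\<^sub>C orth_proj H x \<in> H"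
    using H orth_proj_in[of x]
    by (auto simp: closed_csubspace_def intro!: complex_vector.subspace_scale)
  show "cinner (a *\<^sub>C x - a *\<^sub>C orth_proj H x) z = 0" if "z \<in> H" for z
    using orth_proj_orthogonal[OF that, of x]
    by (simp add: scaleC.diff_right[symmetric] cinner_scaleC_left)
qed

end

section \<open>Invertible bounded operators\<close>

primrec blinfun_power :: "'a::real_normed_vector \<Rightarrow>\<^sub>L 'a \<Rightarrow> nat \<Rightarrow> 'a \<Rightarrow>\<^sub>L 'a" where
  "blinfun_power A 0 = id_blinfun"
| "blinfun_power A (Suc m) = A o\<^sub>L blinfun_power A m"

lemma blinfun_apply_power: "blinfun_apply (blinfun_power A m) = blinfun_apply A ^^ m"
  by (induction m) (auto simp: fun_eq_iff)

lemma tendsto_blinfun_power [tendsto_intros]: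
  "(f \<longlongrightarrow> A) F \<Longrightarrow> ((\<lambda>x. blinfun_power (f x) m) \<longlongrightarrow> blinfun_power A m) F"
  by (induction m)
    (auto intro!: tendsto_intros bounded_bilinear.tendsto[OF bounded_bilinear_blinfun_compose])

lemma norm_blinfun_power_le: "norm (blinfun_power A m) \<le> norm A ^ m"
proof (induction m)
  case (Suc m)
  then show ?case
    using order_trans[OF norm_blinfun_compose mult_left_mono[OF Suc norm_ge_zero]] by simp
qed (simp add: norm_blinfun_id_le)

definition blinfun_inverses :: "'a::real_normed_vector \<Rightarrow>\<^sub>L 'a \<Rightarrow> 'a \<Rightarrow>\<^sub>L 'a \<Rightarrow> bool" where
  "blinfun_inverses X Y \<longleftrightarrow> X o\<^sub>L Y = id_blinfun \<and> Y o\<^sub>L X = id_blinfun"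

lemma blinfun_inverses_apply:
  "blinfun_inverses X Y \<longleftrightarrow> (\<forall>x. X (Y x) = x) \<and> (\<forall>x. Y (X x) = x)"
  by (auto simp: blinfun_inverses_def intro!: blinfun_eqI dest: arg_cong[where f = blinfun_apply] fun_cong)
     (metis blinfun_apply_blinfun_compose blinfun_apply_id_blinfun)+

text \<open>
  The equation \<open>Z x = y\<close> is the fixed point equation \<open>x = Y (y - (Z - X) x)\<close> of a contraction.
\<close>

lemma blinfun_inverses_perturb:
  fixes X :: "'a::banach \<Rightarrow>\<^sub>L 'a"
  assumes XY: "blinfun_inverses X Y" and small: "norm Y * norm (Z - X) \<le> 1 / 2"
  obtains W where "blinfun_inverses Z W" "norm W \<le> 2 * norm Y"
proof -
  have Y: "X (Y x) = x" "Y (X x) = x" for x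
    using XY by (auto simp: blinfun_inverses_apply)
  have fixpoint: "Z x = y \<longleftrightarrow> Y (y - (Z - X) x) = x" for x y
  proof -
    have "Y (y - (Z - X) x) = x + Y (y - Z x)"
      by (simp add: blinfun.bilinear_simps Y)
    moreover have "Y (y - Z x) = 0 \<longleftrightarrow> y - Z x = 0"
      by (metis Y(1) blinfun.zero_right)
    ultimately show ?thesis by auto
  qed
  have small_apply: "norm (Y ((Z - X) x)) \<le> 1/2 * norm x" for x
  proof -
    have "norm (Y ((Z - X) x)) \<le> norm (Y o\<^sub>L (Z - X)) * norm x"
      using norm_blinfun[of "Y o\<^sub>L (Z - X)" x] by simp
    also have "\<dots> \<le> 1/2 * norm x"
      by (intro mult_right_mono order_trans[OF norm_blinfun_compose small]) simp
    finally show ?thesis .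
  qed
  have "\<exists>!x. Y (y - (Z - X) x) = x" for y
  proof (rule banach_fix_type[where c = "1/2"])
    show "\<forall>x x'. dist (Y (y - (Z - X) x)) (Y (y - (Z - X) x')) \<le> 1/2 * dist x x'"
    proof (intro allI)
      fix x x'
      show "dist (Y (y - (Z - X) x)) (Y (y - (Z - X) x')) \<le> 1/2 * dist x x'"
        using small_apply[of "x' - x"]
        by (simp only: dist_norm blinfun.diff_right[symmetric] diff_diff_eq2 norm_minus_commute
            add_diff_cancel_left' diff_add_eq) (simp add: blinfun.bilinear_simps algebra_simps norm_minus_commute)
    qed
  qed auto
  then have ex1: "\<exists>!x. Z x = y" for y
    by (simp add: fixpoint)
  define V where "V y = (THE x. Z x = y)" for y
  have ZV: "Z (V y) = y" for y
    unfolding V_def by (rule theI'[OF ex1])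
  have V_eqI: "Z x = y \<Longrightarrow> V y = x" for x y
    using ex1[of y] ZV[of y] by auto
  \<comment> \<open>The contraction term is at most half of \<open>norm (V y)\<close> and is
    absorbed on the left, which gives the factor 2.\<close>
  have V_norm: "norm (V y) \<le> norm y * (2 * norm Y)" for y
  proof -
    have "V y = Y y - Y ((Z - X) (V y))"
      using iffD1[OF fixpoint ZV[of y]] by (simp add: blinfun.diff_right)
    then have "norm (V y) \<le> norm (Y y) + norm (Y ((Z - X) (V y)))"
      by (metis norm_triangle_ineq4)
    also have "\<dots> \<le> norm Y * norm y + 1/2 * norm (V y)"
      by (intro add_mono norm_blinfun small_apply)
    finally show ?thesis by (simp add: mult.commute)
  qed
  have "bounded_linear V"
  proof (rule bounded_linear_intro)
    show "V (x + y) = V x + V y" for x y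
      by (rule V_eqI) (simp add: blinfun.add_right ZV)
    show "V (r *\<^sub>R x) = r *\<^sub>R V x" for r x
      by (rule V_eqI) (simp add: blinfun.scaleR_right ZV)
  qed (rule V_norm)
  then have Vapp: "blinfun_apply (Blinfun V) = V"
    by (rule bounded_linear_Blinfun_apply)
  show thesis
  proof (rule that)
    show "blinfun_inverses Z (Blinfun V)"
      by (simp add: blinfun_inverses_apply Vapp ZV V_eqI)
    show "norm (Blinfun V) \<le> 2 * norm Y"
      using V_norm by (intro norm_blinfun_bound) (simp_all add: Vapp mult.commute)
  qed
qed

text \<open>Inversion is continuous: \<open>W k - Y = W k (X - Z k) Y\<close>, and the perturbation
  bound keeps \<open>norm (W k)\<close> below \<open>2 * norm Y\<close>.\<close>

lemma tendsto_blinfun_inverses: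
  fixes X :: "'a::banach \<Rightarrow>\<^sub>L 'a"
  assumes XY: "blinfun_inverses X Y" and Z: "(Z \<longlongrightarrow> X) F"
  obtains W where "\<forall>\<^sub>F k in F. blinfun_inverses (Z k) (W k)" "(W \<longlongrightarrow> Y) F"
proof -
  have lim0: "((\<lambda>k. norm Y * norm (Z k - X)) \<longlongrightarrow> 0) F"
    using tendsto_mult_right_zero[OF tendsto_norm_zero[OF LIM_zero[OF Z]]] .
  have "\<forall>\<^sub>F k in F. norm Y * norm (Z k - X) < 1 / 2"
    by (rule order_tendstoD(2)[OF lim0]) simp
  then have ex: "\<forall>\<^sub>F k in F. \<exists>W. blinfun_inverses (Z k) W \<and> norm W \<le> 2 * norm Y"
    by eventually_elim (use blinfun_inverses_perturb[OF XY] less_imp_le in metis)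
  define W where "W k = (SOME W. blinfun_inverses (Z k) W \<and> norm W \<le> 2 * norm Y)" for k
  have W: "\<forall>\<^sub>F k in F. blinfun_inverses (Z k) (W k) \<and> norm (W k) \<le> 2 * norm Y"
    using ex by eventually_elim (unfold W_def, rule someI_ex)
  have "(W \<longlongrightarrow> Y) F"
  proof (rule LIM_zero_cancel, rule tendsto_norm_zero_cancel, rule tendsto_0_le)
    show "((\<lambda>k. norm Y * norm (Z k - X)) \<longlongrightarrow> 0) F" by (rule lim0)
    show "\<forall>\<^sub>F k in F. norm (norm (W k - Y)) \<le> norm (norm Y * norm (Z k - X)) * (2 * norm Y)"
      using W
    proof eventually_elim
      case (elim k)
      have "W k - Y = W k o\<^sub>L ((X - Z k) o\<^sub>L Y)"
        using XY elim by (intro blinfun_eqI) (simp add: blinfun_inverses_apply blinfun.bilinear_simps)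
      then have "norm (W k - Y) \<le> norm (W k) * (norm (X - Z k) * norm Y)"
        by (simp only:) (intro order_trans[OF norm_blinfun_compose] mult_left_mono norm_blinfun_compose norm_ge_zero)
      also have "\<dots> \<le> 2 * norm Y * (norm (X - Z k) * norm Y)"
        using elim by (intro mult_right_mono) auto
      finally show ?case
        by (simp add: norm_minus_commute mult_ac)
    qed
  qed
  with W that show thesis
    by (metis (no_types, lifting) eventually_mono)
qed

section \<open>The resolvent as an operator on the whole space\<close>

text \<open>\<open>Blinfun\<close> reproduces its argument only if that is bounded and linear, so
  the value is used only for \<open>z\<close> in the resolvent set.\<close>

definition resolvent_blinfun ::
    "'a::complex_hilbert_space set \<Rightarrow> 'a unbounded_op \<Rightarrow> complex \<Rightarrow> 'a \<Rightarrow>\<^sub>L 'a" where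
  "resolvent_blinfun H T z = Blinfun (\<lambda>x. resolvent T z (orth_proj H x))"

context
  fixes H :: "'a::complex_hilbert_space set" and T :: "'a unbounded_op"
  assumes H: "closed_csubspace H" and T: "linear_operator_in H T"
begin

lemma shifted_add: "x \<in> op_dom T \<Longrightarrow> y \<in> op_dom T \<Longrightarrow> shifted T z (x + y) = shifted T z x + shifted T z y"
  and shifted_scaleC: "x \<in> op_dom T \<Longrightarrow> shifted T z (a *\<^sub>C x) = a *\<^sub>C shifted T z x"
  using T by (auto simp: linear_operator_in_def shifted_def scaleC_algebra mult.commute)

lemma resolvent_in_dom: "z \<in> resolvent_set H T \<Longrightarrow> y \<in> H \<Longrightarrow> resolvent T z y \<in> op_dom T"
  and shifted_resolvent: "z \<in> resolvent_set H T \<Longrightarrow> y \<in> H \<Longrightarrow> shifted T z (resolvent T z y) = y"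
  and resolvent_shifted:
    "z \<in> resolvent_set H T \<Longrightarrow> x \<in> op_dom T \<Longrightarrow> resolvent T z (shifted T z x) = x"
  unfolding resolvent_set_def resolvent_def bij_betw_def
  by (auto intro: inv_into_into f_inv_into_f inv_into_f_f)

lemma shifted_in: "z \<in> resolvent_set H T \<Longrightarrow> x \<in> op_dom T \<Longrightarrow> shifted T z x \<in> H"
  by (auto simp: resolvent_set_def bij_betw_def)

lemma op_dom_subset: "op_dom T \<subseteq> H"
  using T by (simp add: linear_operator_in_def)

lemma
  assumes z: "z \<in> resolvent_set H T" and x: "x \<in> H"
  shows resolvent_add: "y \<in> H \<Longrightarrow> resolvent T z (x + y) = resolvent T z x + resolvent T z y"
    and resolvent_scaleC: "resolvent T z (a *\<^sub>C x) = a *\<^sub>C resolvent T z x"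
proof -
  have dom: "complex_vector.subspace (op_dom T)"
    using T by (simp add: linear_operator_in_def)
  show "resolvent T z (x + y) = resolvent T z x + resolvent T z y" if "y \<in> H"
    using that x resolvent_in_dom[OF z] shifted_resolvent[OF z]
    by (metis complex_vector.subspace_add[OF dom] resolvent_shifted[OF z] shifted_add)
  show "resolvent T z (a *\<^sub>C x) = a *\<^sub>C resolvent T z x"
    using x resolvent_in_dom[OF z] shifted_resolvent[OF z]
    by (metis complex_vector.subspace_scale[OF dom] resolvent_shifted[OF z] shifted_scaleC)
qed

lemma resolvent_blinfun_apply:
  assumes z: "z \<in> resolvent_set H T"
  shows "resolvent_blinfun H T z x = resolvent T z (orth_proj H x)"
proof -
  obtain C where C: "\<And>y. y \<in> H \<Longrightarrow> norm (resolvent T z y) \<le> C * norm y"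
    using z by (auto simp: resolvent_set_def)
  have "bounded_linear (\<lambda>x. resolvent T z (orth_proj H x))"
  proof (rule bounded_linear_intro[where K = "\<bar>C\<bar>"])
    fix x y and r :: real
    show "resolvent T z (orth_proj H (x + y)) = resolvent T z (orth_proj H x) + resolvent T z (orth_proj H y)"
      by (simp add: orth_proj_add[OF H] resolvent_add[OF z] orth_proj_in[OF H])
    show "resolvent T z (orth_proj H (r *\<^sub>R x)) = r *\<^sub>R resolvent T z (orth_proj H x)"
      by (simp add: orth_proj_scaleC[OF H] resolvent_scaleC[OF z] orth_proj_in[OF H]
          scaleC_of_real[symmetric])
    have "norm (resolvent T z (orth_proj H x)) \<le> C * norm (orth_proj H x)"
      by (rule C[OF orth_proj_in[OF H]])
    also have "\<dots> \<le> \<bar>C\<bar> * norm x"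
      by (intro mult_mono norm_orth_proj_le[OF H]) auto
    finally show "norm (resolvent T z (orth_proj H x)) \<le> norm x * \<bar>C\<bar>"
      by (simp add: mult.commute)
  qed
  then show ?thesis
    by (simp add: resolvent_blinfun_def bounded_linear_Blinfun_apply)
qed

lemma resolvent_blinfun_in_dom: "z \<in> resolvent_set H T \<Longrightarrow> resolvent_blinfun H T z x \<in> op_dom T"
  by (simp add: resolvent_blinfun_apply resolvent_in_dom orth_proj_in[OF H])

lemma resolvent_blinfun_in: "z \<in> resolvent_set H T \<Longrightarrow> resolvent_blinfun H T z x \<in> H"
  using resolvent_blinfun_in_dom op_dom_subset by blast

lemma resolvent_blinfun_eq: "z \<in> resolvent_set H T \<Longrightarrow> x \<in> H \<Longrightarrow> resolvent_blinfun H T z x = resolvent T z x"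
  by (simp add: resolvent_blinfun_apply orth_proj_of_mem[OF H])

lemma resolvent_blinfun_scaleC:
  "z \<in> resolvent_set H T \<Longrightarrow> resolvent_blinfun H T z (a *\<^sub>C x) = a *\<^sub>C resolvent_blinfun H T z x"
  by (simp add: resolvent_blinfun_apply orth_proj_scaleC[OF H] resolvent_scaleC orth_proj_in[OF H])

text \<open>The first resolvent identity for the extended resolvents. It survives the extension
  because the resolvent takes values in \<open>H\<close>, where the projection acts as the
  identity.\<close>

lemma resolvent_identity:
  assumes w: "w \<in> resolvent_set H T" and z: "z \<in> resolvent_set H T"
  shows "resolvent_blinfun H T z y =
    resolvent_blinfun H T w y + (z - w) *\<^sub>C resolvent_blinfun H T w (resolvent_blinfun H T z y)"
proof -
  define x where "x = resolvent_blinfun H T z y"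
  have xD: "x \<in> op_dom T" and xH: "x \<in> H"
    using resolvent_blinfun_in_dom[OF z] resolvent_blinfun_in[OF z] by (auto simp: x_def)
  have "shifted T z x = orth_proj H y"
    by (simp add: x_def resolvent_blinfun_apply[OF z] shifted_resolvent[OF z] orth_proj_in[OF H])
  then have "shifted T w x = orth_proj H y + (z - w) *\<^sub>C x"
    by (simp add: shifted_def scaleC_algebra algebra_simps)
  then have "x = resolvent T w (orth_proj H (y + (z - w) *\<^sub>C x))"
    using resolvent_shifted[OF w xD]
    by (simp add: orth_proj_add[OF H] orth_proj_scaleC[OF H] orth_proj_of_mem[OF H xH])
  also have "\<dots> = resolvent_blinfun H T w (y + (z - w) *\<^sub>C x)"
    by (simp add: resolvent_blinfun_apply[OF w])
  finally show ?thesis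
    by (simp add: blinfun.add_right resolvent_blinfun_scaleC[OF w] x_def[symmetric])
qed

text \<open>Multiplying out either product leaves the identity plus a multiple of a resolvent
  identity; the two orders use it with \<open>w\<close> and \<open>z\<close> in the two
  roles.\<close>

lemma blinfun_inverses_resolvent:
  assumes w: "w \<in> resolvent_set H T" and z: "z \<in> resolvent_set H T"
  shows "blinfun_inverses (id_blinfun - (blinfun_scaleC (z - w) o\<^sub>L resolvent_blinfun H T w))
    (id_blinfun + (blinfun_scaleC (z - w) o\<^sub>L resolvent_blinfun H T z))"
proof -
  define c where "c = z - w"
  note sc = resolvent_blinfun_scaleC[OF w] resolvent_blinfun_scaleC[OF z]
  have 1: "c *\<^sub>C resolvent_blinfun H T w (resolvent_blinfun H T z x) =
      resolvent_blinfun H T z x - resolvent_blinfun H T w x" for x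
    unfolding c_def by (subst (2) resolvent_identity[OF w z]) simp
  have 2: "c *\<^sub>C resolvent_blinfun H T z (resolvent_blinfun H T w x) =
      resolvent_blinfun H T z x - resolvent_blinfun H T w x" for x
    unfolding c_def by (subst (2) resolvent_identity[OF z w]) (simp add: scaleC_algebra)
  show ?thesis
    unfolding c_def[symmetric]
    by (simp add: blinfun_inverses_apply blinfun.bilinear_simps sc scaleC_algebra(1-7) 1 2)
qed

text \<open>With \<open>A\<close> the resolvent at \<open>w\<close> and \<open>c = z - w\<close>,
  the factorisation \<open>T - z = (1 - c A) (T - w)\<close> holds on \<open>op_dom T\<close>, so
  \<open>A W\<close> inverts \<open>T - z\<close> on \<open>H\<close>.\<close>

lemma resolvent_set_of_blinfun_inverses:
  assumes w: "w \<in> resolvent_set H T"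
    and W: "blinfun_inverses (id_blinfun - (blinfun_scaleC (z - w) o\<^sub>L resolvent_blinfun H T w)) W"
  shows "z \<in> resolvent_set H T" and "resolvent_blinfun H T z = resolvent_blinfun H T w o\<^sub>L W"
proof -
  define c where "c = z - w"
  define A where "A = resolvent_blinfun H T w"
  have W1: "W x - c *\<^sub>C A (W x) = x" and W2: "W (x - c *\<^sub>C A x) = x" for x
    using W by (auto simp: blinfun_inverses_apply blinfun.bilinear_simps A_def c_def)
  have AH: "A x \<in> H" and AD: "A x \<in> op_dom T" for x
    using resolvent_blinfun_in[OF w] resolvent_blinfun_in_dom[OF w] by (auto simp: A_def)
  have sub: "complex_vector.subspace H"
    using H by (simp add: closed_csubspace_def)
  \<comment> \<open>\<open>W\<close> is an inverse on the whole space; it preserves \<open>H\<close>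
    because it differs from the identity by an operator with range in \<open>H\<close>.\<close>
  have WH: "W x \<in> H" if "x \<in> H" for x
  proof -
    have "W x = x + c *\<^sub>C A (W x)"
      using W1[of x] by (simp add: algebra_simps)
    then show ?thesis
      by (metis AH complex_vector.subspace_add[OF sub] complex_vector.subspace_scale[OF sub] that)
  qed
  have sh: "shifted T z x = shifted T w x - c *\<^sub>C A (shifted T w x)" if "x \<in> op_dom T" for x
    using that w
    by (simp add: A_def resolvent_blinfun_eq shifted_in resolvent_shifted)
      (simp add: shifted_def c_def scaleC_algebra)
  have inj: "inj_on (shifted T z) (op_dom T)"
    by (rule inj_onI) (metis W2 sh resolvent_shifted[OF w])
  have wA: "shifted T w (A y) = y" if "y \<in> H" for y
    using that by (simp add: A_def resolvent_blinfun_eq[OF w] shifted_resolvent[OF w])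
  have zAW: "shifted T z (A (W y)) = y" if "y \<in> H" for y
    using sh[OF AD, of "W y"] wA[OF WH[OF that]] W1 by simp
  have "shifted T z x \<in> H" if "x \<in> op_dom T" for x
    using sh[OF that] shifted_in[OF w that] AH
    by (metis complex_vector.subspace_diff[OF sub] complex_vector.subspace_scale[OF sub])
  then have bij: "bij_betw (shifted T z) (op_dom T) H"
    using inj zAW AD by (auto simp: bij_betw_def image_def) metis
  have res: "resolvent T z y = A (W y)" if "y \<in> H" for y
    unfolding resolvent_def using inv_into_f_f[OF inj AD, of "W y"] zAW[OF that] by simp
  have "norm (resolvent T z y) \<le> norm (A o\<^sub>L W) * norm y" if "y \<in> H" for y
    using norm_blinfun[of "A o\<^sub>L W" y] res[OF that] by simp
  with bij show z: "z \<in> resolvent_set H T"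
    by (auto simp: resolvent_set_def)
  \<comment> \<open>The extended resolvent at \<open>z\<close> is \<open>A W P\<close> with
    \<open>P\<close> the projection. Commuting \<open>W\<close> with \<open>A\<close> and using
    \<open>A P = A\<close> removes \<open>P\<close>.\<close>
  have AW: "A (W x) = W (A x)" for x
  proof -
    have "A x = A (W x - c *\<^sub>C A (W x))" by (simp add: W1)
    also have "\<dots> = A (W x) - c *\<^sub>C A (A (W x))"
      by (simp add: blinfun.diff_right A_def resolvent_blinfun_scaleC[OF w])
    finally show ?thesis by (metis W2)
  qed
  have AP: "A (orth_proj H x) = A x" for x
    by (simp add: A_def resolvent_blinfun_apply[OF w] orth_proj_of_mem[OF H] orth_proj_in[OF H])
  show "resolvent_blinfun H T z = resolvent_blinfun H T w o\<^sub>L W"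
  proof (rule blinfun_eqI)
    fix x
    have "resolvent_blinfun H T z x = A (W (orth_proj H x))"
      by (simp add: resolvent_blinfun_apply[OF z] res orth_proj_in[OF H])
    then show "resolvent_blinfun H T z x = (resolvent_blinfun H T w o\<^sub>L W) x"
      by (simp add: AW AP flip: A_def)
  qed
qed

text \<open>Passing from \<open>H\<close> to the whole space does not change the norm: a positive
  power of the extended resolvent absorbs the projection onto \<open>H\<close>, which has norm at
  most 1.\<close>

lemma resolvent_power_norm_eq:
  assumes z: "z \<in> resolvent_set H T"
  shows "resolvent_power_norm n H T z = norm (blinfun_power (resolvent_blinfun H T z) (2 ^ n))"
proof -
  define R where "R = resolvent_blinfun H T z"
  \<comment> \<open>The exponent is at least 1; the zeroth power would be the identity and would not
    absorb the projection.\<close>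
  define m where "m = (2::nat) ^ n - 1"
  have m: "2 ^ n = Suc m" by (simp add: m_def)
  have pow: "(resolvent T z ^^ k) x = (blinfun_apply R ^^ k) x \<and> (blinfun_apply R ^^ k) x \<in> H" if "x \<in> H" for x k
    using that by (induction k)
      (auto simp: R_def simp flip: resolvent_blinfun_eq[OF z] intro: resolvent_blinfun_in[OF z])
  have RP: "(blinfun_apply R ^^ Suc m) (orth_proj H x) = (blinfun_apply R ^^ Suc m) x" for x
  proof -
    have "R (orth_proj H x) = R x" for x
      by (simp add: R_def resolvent_blinfun_apply[OF z] orth_proj_of_mem[OF H] orth_proj_in[OF H])
    then show ?thesis
      by (simp add: funpow_swap1 del: funpow.simps add: funpow_Suc_right)
  qed
  have bound: "norm ((blinfun_apply R ^^ Suc m) x) \<le> norm (blinfun_power R (Suc m)) * norm x" for x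
    using norm_blinfun[of "blinfun_power R (Suc m)" x] by (simp add: blinfun_apply_power)
  have eq: "resolvent_power_norm n H T z = (SUP x\<in>H. norm ((blinfun_apply R ^^ Suc m) x) / norm x)"
    unfolding resolvent_power_norm_def onorm_on_def m
    by (rule SUP_cong) (simp_all only: pow)
  have "0 \<in> H"
    using H complex_vector.subspace_0 by (auto simp: closed_csubspace_def)
  then have ne: "H \<noteq> {}" by auto
  have quot: "norm ((blinfun_apply R ^^ Suc m) x) / norm x \<le> norm (blinfun_power R (Suc m))" for x
    using bound[of x] by (cases "x = 0") (auto simp: divide_le_eq simp del: funpow.simps)
  then have bdd: "bdd_above ((\<lambda>x. norm ((blinfun_apply R ^^ Suc m) x) / norm x) ` H)"
    by (auto intro!: bdd_aboveI2)
  define S where "S = (SUP x\<in>H. norm ((blinfun_apply R ^^ Suc m) x) / norm x)"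
  have S: "norm ((blinfun_apply R ^^ Suc m) x) / norm x \<le> S" if "x \<in> H" for x
    unfolding S_def using bdd that by (rule cSUP_upper2) auto
  have S0: "0 \<le> S" using S[OF \<open>0 \<in> H\<close>] by simp
  have "norm (blinfun_power R (Suc m)) \<le> S"
  proof (rule norm_blinfun_bound[OF S0])
    fix x
    have "norm ((blinfun_apply R ^^ Suc m) (orth_proj H x)) \<le> S * norm (orth_proj H x)"
    proof (cases "orth_proj H x = 0")
      case True
      then show ?thesis using bound[of 0] by simp
    next
      case False
      then show ?thesis using S[OF orth_proj_in[OF H, of x]] by (simp add: divide_le_eq del: funpow.simps)
    qed
    also have "\<dots> \<le> S * norm x"
      by (intro mult_left_mono norm_orth_proj_le[OF H] S0)
    finally show "norm (blinfun_power R (Suc m) x) \<le> S * norm x"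
      by (simp only: RP blinfun_apply_power)
  qed
  moreover have "S \<le> norm (blinfun_power R (Suc m))"
    unfolding S_def by (rule cSUP_least[OF ne]) (rule quot)
  ultimately show ?thesis
    unfolding eq m R_def[symmetric] S_def[symmetric] by simp
qed

end

section \<open>Generalised norm resolvent convergence\<close>

text \<open>Continuity of inversion applied to \<open>1 - (\<zeta> k - \<mu>) A k\<close>, with
  \<open>A k\<close> the resolvent at \<open>\<mu>\<close>. The filter and the index type are
  arbitrary and the point may move, so that constant families later yield openness of the resolvent
  set and continuity of the resolvent.\<close>

lemma resolvent_tendsto:
  assumes H: "closed_csubspace H" and T: "linear_operator_in H T"
    and Hk: "\<And>k. closed_csubspace (Hk k)" and Tk: "\<And>k. linear_operator_in (Hk k) (Tk k)"
    and \<mu>: "\<mu> \<in> resolvent_set H T" and \<mu>k: "\<And>k. \<mu> \<in> resolvent_set (Hk k) (Tk k)"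
    and conv: "((\<lambda>k. resolvent_blinfun (Hk k) (Tk k) \<mu>) \<longlongrightarrow> resolvent_blinfun H T \<mu>) F"
    and z: "z \<in> resolvent_set H T" and \<zeta>: "(\<zeta> \<longlongrightarrow> z) F"
  shows "\<forall>\<^sub>F k in F. \<zeta> k \<in> resolvent_set (Hk k) (Tk k)"
    and "((\<lambda>k. resolvent_blinfun (Hk k) (Tk k) (\<zeta> k)) \<longlongrightarrow> resolvent_blinfun H T z) F"
proof -
  note compose = bounded_bilinear.tendsto[OF bounded_bilinear_blinfun_compose]
  note scale = bounded_linear.tendsto[OF bounded_linear_blinfun_scaleC]
  define Y where "Y = id_blinfun + (blinfun_scaleC (z - \<mu>) o\<^sub>L resolvent_blinfun H T z)"
  define Z where
    "Z k = id_blinfun - (blinfun_scaleC (\<zeta> k - \<mu>) o\<^sub>L resolvent_blinfun (Hk k) (Tk k) \<mu>)" for k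
  have XY: "blinfun_inverses (id_blinfun - (blinfun_scaleC (z - \<mu>) o\<^sub>L resolvent_blinfun H T \<mu>)) Y"
    unfolding Y_def by (rule blinfun_inverses_resolvent[OF H T \<mu> z])
  have "(Z \<longlongrightarrow> id_blinfun - (blinfun_scaleC (z - \<mu>) o\<^sub>L resolvent_blinfun H T \<mu>)) F"
    unfolding Z_def by (intro tendsto_intros compose scale \<zeta> conv)
  from tendsto_blinfun_inverses[OF XY this]
  obtain W where W: "\<forall>\<^sub>F k in F. blinfun_inverses (Z k) (W k)" and WY: "(W \<longlongrightarrow> Y) F"
    by blast
  show "\<forall>\<^sub>F k in F. \<zeta> k \<in> resolvent_set (Hk k) (Tk k)"
    using W by eventually_elim
      (use resolvent_set_of_blinfun_inverses(1)[OF Hk Tk \<mu>k] in \<open>simp add: Z_def\<close>)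
  have "\<forall>\<^sub>F k in F. resolvent_blinfun (Hk k) (Tk k) \<mu> o\<^sub>L W k = resolvent_blinfun (Hk k) (Tk k) (\<zeta> k)"
    using W by eventually_elim
      (use resolvent_set_of_blinfun_inverses(2)[OF Hk Tk \<mu>k] in \<open>simp add: Z_def\<close>)
  moreover have "((\<lambda>k. resolvent_blinfun (Hk k) (Tk k) \<mu> o\<^sub>L W k) \<longlongrightarrow> resolvent_blinfun H T \<mu> o\<^sub>L Y) F"
    by (intro compose conv WY)
  moreover have "resolvent_blinfun H T \<mu> o\<^sub>L Y = resolvent_blinfun H T z"
    using resolvent_set_of_blinfun_inverses(2)[OF H T \<mu> XY] by simp
  ultimately show "((\<lambda>k. resolvent_blinfun (Hk k) (Tk k) (\<zeta> k)) \<longlongrightarrow> resolvent_blinfun H T z) F"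
    by (auto dest: Lim_transform_eventually)
qed

text \<open>The bound \<open>D\<close> bounds the inverses of \<open>Z k\<close> uniformly, while
  \<open>Z k\<close> converges to \<open>X\<close>. A single \<open>k\<close> with
  \<open>Z k\<close> close enough to \<open>X\<close> then makes \<open>X\<close> invertible as a
  perturbation of \<open>Z k\<close>.\<close>

lemma resolvent_set_of_bounded_resolvents:
  assumes H: "closed_csubspace H" and T: "linear_operator_in H T"
    and Hk: "\<And>k. closed_csubspace (Hk k)" and Tk: "\<And>k. linear_operator_in (Hk k) (Tk k)"
    and \<mu>: "\<mu> \<in> resolvent_set H T" and \<mu>k: "\<And>k. \<mu> \<in> resolvent_set (Hk k) (Tk k)"
    and conv: "((\<lambda>k. resolvent_blinfun (Hk k) (Tk k) \<mu>) \<longlongrightarrow> resolvent_blinfun H T \<mu>) F"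
    and freq: "\<exists>\<^sub>F k in F. z \<in> resolvent_set (Hk k) (Tk k) \<and> norm (resolvent_blinfun (Hk k) (Tk k) z) \<le> D"
  shows "z \<in> resolvent_set H T"
proof -
  define X where
    "X = id_blinfun - (blinfun_scaleC (z - \<mu>) o\<^sub>L resolvent_blinfun H T \<mu>)"
  define Z where
    "Z k = id_blinfun - (blinfun_scaleC (z - \<mu>) o\<^sub>L resolvent_blinfun (Hk k) (Tk k) \<mu>)" for k
  define Y where
    "Y k = id_blinfun + (blinfun_scaleC (z - \<mu>) o\<^sub>L resolvent_blinfun (Hk k) (Tk k) z)" for k
  define b where "b = 1 + cmod (z - \<mu>) * D"
  have "(Z \<longlongrightarrow> X) F"
    unfolding Z_def X_def
    by (intro tendsto_intros bounded_bilinear.tendsto[OF bounded_bilinear_blinfun_compose] conv)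
  then have "((\<lambda>k. b * norm (Z k - X)) \<longlongrightarrow> 0) F"
    by (intro tendsto_mult_right_zero tendsto_norm_zero LIM_zero)
  then have "\<forall>\<^sub>F k in F. b * norm (Z k - X) < 1 / 2"
    by (rule order_tendstoD) simp
  then obtain k where k: "b * norm (Z k - X) < 1 / 2" and zk: "z \<in> resolvent_set (Hk k) (Tk k)"
    and D: "norm (resolvent_blinfun (Hk k) (Tk k) z) \<le> D"
    using frequently_ex[OF frequently_eventually_conj[OF freq]] by blast
  have ZY: "blinfun_inverses (Z k) (Y k)"
    unfolding Z_def Y_def by (rule blinfun_inverses_resolvent[OF Hk Tk \<mu>k zk])
  have "norm (Y k) \<le> b"
    unfolding Y_def b_def
    by (rule norm_triangle_le, rule add_mono[OF norm_blinfun_id_le],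
        rule order_trans[OF norm_blinfun_scaleC_compose_le mult_left_mono[OF D norm_ge_zero]])
  then have "norm (Y k) * norm (X - Z k) \<le> 1 / 2"
    using mult_right_mono[OF _ norm_ge_zero, of _ _ "Z k - X"] k
    by (fastforce simp: norm_minus_commute[of X])
  from blinfun_inverses_perturb[OF ZY this] obtain W where "blinfun_inverses X W"
    by blast
  then show ?thesis
    unfolding X_def by (rule resolvent_set_of_blinfun_inverses(1)[OF H T \<mu>])
qed

text \<open>
  For \<open>R = A (1 - c A)\<inverse>\<close> the bound is transported along the powers by
  \<open>A R\<^sup>i = (1 - c A) R\<^sup>i\<^sup>+\<^sup>1\<close> and \<open>A\<^sup>j R = A\<^sup>j\<^sup>+\<^sup>1 + c A\<^sup>j\<^sup>+\<^sup>1 R\<close>.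
\<close>

lemma norm_bound_of_power_bound:
  fixes a C :: real and c :: complex
  shows "\<exists>D. \<forall>(A :: 'a::complex_hilbert_space \<Rightarrow>\<^sub>L 'a) (R :: 'a \<Rightarrow>\<^sub>L 'a).
    norm A \<le> a \<longrightarrow> (\<forall>s x. blinfun_apply A (s *\<^sub>C x) = s *\<^sub>C A x) \<longrightarrow> (\<forall>x. blinfun_apply R x = blinfun_apply A x + c *\<^sub>C A (R x)) \<longrightarrow>
    norm (blinfun_power R (Suc j)) \<le> C \<longrightarrow> norm R \<le> D"
proof -
  \<comment> \<open>The last condition says \<open>(1 - c A) R = A\<close>; no invertibility of
    \<open>1 - c A\<close> is assumed. The constant sought may depend on \<open>a\<close>,
    \<open>c\<close>, \<open>C\<close> and \<open>j\<close>, but not on \<open>A\<close> and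
    \<open>R\<close>.\<close>
  define good where "good A R \<longleftrightarrow> norm A \<le> a \<and> (\<forall>s x. blinfun_apply A (s *\<^sub>C x) = s *\<^sub>C A x) \<and>
    (\<forall>x. blinfun_apply R x = blinfun_apply A x + c *\<^sub>C A (R x))" for A R :: "'a \<Rightarrow>\<^sub>L 'a"
  have commute: "blinfun_power A j (A x) = A (blinfun_power A j x)" for A :: "'a \<Rightarrow>\<^sub>L 'a" and j x
    by (simp add: blinfun_apply_power funpow_swap1)
  have power_scaleC: "blinfun_power A j (s *\<^sub>C x) = s *\<^sub>C blinfun_power A j x" if "good A R" for A R j s x
    by (induction j) (use that in \<open>auto simp: good_def\<close>)
  \<comment> \<open>Each factor \<open>A\<close> is traded for a factor \<open>R\<close> at the cost
    of \<open>1 + cmod c * a\<close>.\<close>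
  have down: "norm (blinfun_power A j o\<^sub>L blinfun_power R i) \<le> (1 + cmod c * a) ^ j * norm (blinfun_power R (i + j))"
    if good: "good A R" for A R i j
  proof (induction j arbitrary: i)
    case 0
    then show ?case by (auto intro!: order_eq_refl arg_cong[where f = norm] blinfun_eqI)
  next
    case (Suc j)
    have a0: "0 \<le> a"
      using good norm_ge_zero[of A] unfolding good_def by linarith
    define E where "E = blinfun_power A j o\<^sub>L blinfun_power R (Suc i)"
    have "blinfun_power A (Suc j) o\<^sub>L blinfun_power R i = E - (blinfun_scaleC c o\<^sub>L (A o\<^sub>L E))"
    proof (rule blinfun_eqI)
      fix x
      have "R y = A y + c *\<^sub>C A (R y)" for y
        using good unfolding good_def by blast
      then have "A y = R y - c *\<^sub>C A (R y)" for y
        by (metis add_diff_cancel_right')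
      from this[of "blinfun_power R i x"]
      show "(blinfun_power A (Suc j) o\<^sub>L blinfun_power R i) x = (E - (blinfun_scaleC c o\<^sub>L (A o\<^sub>L E))) x"
        by (simp add: E_def commute[symmetric] blinfun.diff_left blinfun.diff_right power_scaleC[OF good]
            del: blinfun_power.simps(1))
    qed
    moreover have "norm (A o\<^sub>L E) \<le> a * norm E"
      using good by (intro order_trans[OF norm_blinfun_compose mult_right_mono]) (auto simp: good_def)
    then have "norm (blinfun_scaleC c o\<^sub>L (A o\<^sub>L E)) \<le> cmod c * (a * norm E)"
      by (rule order_trans[OF norm_blinfun_scaleC_compose_le mult_left_mono[OF _ norm_ge_zero]])
    ultimately have "norm (blinfun_power A (Suc j) o\<^sub>L blinfun_power R i) \<le> norm E + cmod c * (a * norm E)"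
      using norm_triangle_ineq4[of E "blinfun_scaleC c o\<^sub>L (A o\<^sub>L E)"] by simp
    also have "\<dots> = (1 + cmod c * a) * norm E"
      by (simp add: algebra_simps)
    also have "\<dots> \<le> (1 + cmod c * a) * ((1 + cmod c * a) ^ j * norm (blinfun_power R (Suc i + j)))"
      unfolding E_def by (intro mult_left_mono Suc.IH) (simp add: a0)
    finally show ?case by (simp add: mult.assoc)
  qed
  \<comment> \<open>Now the power of \<open>A\<close> is lowered to zero. The bound changes at each
    step, hence the induction over all \<open>C\<close>.\<close>
  have up: "\<exists>D. \<forall>A R. good A R \<longrightarrow> norm (blinfun_power A j o\<^sub>L R) \<le> C \<longrightarrow> norm R \<le> D" for C j
  proof (induction j arbitrary: C)
    case 0
    have "id_blinfun o\<^sub>L R = R" for R :: "'a \<Rightarrow>\<^sub>L 'a" by (rule blinfun_eqI) simp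
    then show ?case by auto
  next
    case (Suc j)
    from Suc.IH[of "a ^ Suc j + cmod c * C"] obtain D where D:
      "\<And>A R. good A R \<Longrightarrow> norm (blinfun_power A j o\<^sub>L R) \<le> a ^ Suc j + cmod c * C \<Longrightarrow> norm R \<le> D"
      by blast
    have "norm R \<le> D" if good: "good A R" and C: "norm (blinfun_power A (Suc j) o\<^sub>L R) \<le> C" for A R
    proof (rule D[OF good])
      have "blinfun_power A j o\<^sub>L R =
          blinfun_power A (Suc j) + (blinfun_scaleC c o\<^sub>L (blinfun_power A (Suc j) o\<^sub>L R))"
      proof (rule blinfun_eqI)
        fix x
        have "R x = A x + c *\<^sub>C A (R x)"
          using good unfolding good_def by blast
        then have "blinfun_power A j (R x) = blinfun_power A j (A x + c *\<^sub>C A (R x))" by simp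
        then show "(blinfun_power A j o\<^sub>L R) x = (blinfun_power A (Suc j) +
            (blinfun_scaleC c o\<^sub>L (blinfun_power A (Suc j) o\<^sub>L R))) x"
          by (simp add: blinfun.bilinear_simps power_scaleC[OF good] commute)
      qed
      moreover have "norm (blinfun_power A (Suc j)) \<le> a ^ Suc j"
        using good by (intro order_trans[OF norm_blinfun_power_le] power_mono) (auto simp: good_def)
      moreover have "norm (blinfun_scaleC c o\<^sub>L (blinfun_power A (Suc j) o\<^sub>L R)) \<le> cmod c * C"
        by (rule order_trans[OF norm_blinfun_scaleC_compose_le mult_left_mono[OF C norm_ge_zero]])
      ultimately show "norm (blinfun_power A j o\<^sub>L R) \<le> a ^ Suc j + cmod c * C"
        using norm_triangle_le[OF add_mono] by (metis (no_types, lifting))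
    qed
    then show ?case by blast
  qed
  \<comment> \<open>With one factor \<open>R\<close> present, trading all \<open>j\<close> factors
    \<open>A\<close> leads to exactly the power \<open>Suc j\<close> of \<open>R\<close>.\<close>
  from up[of j "(1 + cmod c * a) ^ j * C"] obtain D where D:
    "\<And>A R. good A R \<Longrightarrow> norm (blinfun_power A j o\<^sub>L R) \<le> (1 + cmod c * a) ^ j * C \<Longrightarrow> norm R \<le> D"
    by blast
  have "norm R \<le> D" if good: "good A R" and C: "norm (blinfun_power R (Suc j)) \<le> C" for A R
  proof (rule D[OF good])
    have "0 \<le> a"
      using good norm_ge_zero[of A] unfolding good_def by linarith
    moreover have "blinfun_power R 1 = R"
      by (auto intro: blinfun_eqI)
    ultimately show "norm (blinfun_power A j o\<^sub>L R) \<le> (1 + cmod c * a) ^ j * C"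
      using order_trans[OF down[OF good, of j 1, unfolded plus_1_eq_Suc] mult_left_mono[OF C]] by simp
  qed
  then show ?thesis
    unfolding good_def by (intro exI[of _ D]) blast
qed

text \<open>Otherwise \<open>norm_bound_of_power_bound\<close>, applied to the resolvents at
  \<open>\<mu>\<close> and at \<open>z\<close>, would bound the latter frequently, and
  \<open>z\<close> would lie in the resolvent set of \<open>T\<close>. Where \<open>z\<close> is in
  the spectrum of \<open>Tk k\<close> the norm counts as infinite, hence the implication.\<close>

lemma resolvent_power_norm_unbounded:
  assumes H: "closed_csubspace H" and T: "linear_operator_in H T"
    and Hk: "\<And>k. closed_csubspace (Hk k)" and Tk: "\<And>k. linear_operator_in (Hk k) (Tk k)"
    and \<mu>: "\<mu> \<in> resolvent_set H T" and \<mu>k: "\<And>k. \<mu> \<in> resolvent_set (Hk k) (Tk k)"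
    and conv: "((\<lambda>k. resolvent_blinfun (Hk k) (Tk k) \<mu>) \<longlongrightarrow> resolvent_blinfun H T \<mu>) F"
    and z: "z \<in> spectrum H T"
  shows "\<forall>\<^sub>F k in F. z \<in> resolvent_set (Hk k) (Tk k) \<longrightarrow> C < resolvent_power_norm n (Hk k) (Tk k) z"
proof (rule ccontr)
  assume "\<not> ?thesis"
  then have freq: "\<exists>\<^sub>F k in F. z \<in> resolvent_set (Hk k) (Tk k) \<and>
      resolvent_power_norm n (Hk k) (Tk k) z \<le> C"
    by (simp add: frequently_def not_le)
  define j where "j = (2::nat) ^ n - 1"
  have j: "2 ^ n = Suc j" by (simp add: j_def)
  \<comment> \<open>The added 1 makes \<open>a\<close> eventually a bound for the resolvents of all
    \<open>Tk k\<close> at \<open>\<mu>\<close>.\<close>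
  define a where "a = norm (resolvent_blinfun H T \<mu>) + 1"
  from norm_bound_of_power_bound[where 'a = 'a, of a "z - \<mu>" j C] obtain D where D:
    "\<And>(A :: 'a \<Rightarrow>\<^sub>L 'a) (R :: 'a \<Rightarrow>\<^sub>L 'a). norm A \<le> a \<Longrightarrow> (\<forall>s x. blinfun_apply A (s *\<^sub>C x) = s *\<^sub>C A x) \<Longrightarrow>
      (\<forall>x. blinfun_apply R x = blinfun_apply A x + (z - \<mu>) *\<^sub>C A (R x)) \<Longrightarrow> norm (blinfun_power R (Suc j)) \<le> C \<Longrightarrow> norm R \<le> D"
    by blast
  have "\<forall>\<^sub>F k in F. norm (resolvent_blinfun (Hk k) (Tk k) \<mu>) < a"
    by (rule order_tendstoD(2)[OF tendsto_norm[OF conv]]) (simp add: a_def)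
  from frequently_eventually_conj[OF freq this]
  have "\<exists>\<^sub>F k in F. z \<in> resolvent_set (Hk k) (Tk k) \<and> norm (resolvent_blinfun (Hk k) (Tk k) z) \<le> D"
  proof (rule frequently_elim1)
    fix k
    assume k: "norm (resolvent_blinfun (Hk k) (Tk k) \<mu>) < a \<and> z \<in> resolvent_set (Hk k) (Tk k) \<and>
      resolvent_power_norm n (Hk k) (Tk k) z \<le> C"
    then have "norm (resolvent_blinfun (Hk k) (Tk k) z) \<le> D"
      using resolvent_identity[OF Hk Tk \<mu>k] resolvent_blinfun_scaleC[OF Hk Tk \<mu>k]
      by (intro D[of "resolvent_blinfun (Hk k) (Tk k) \<mu>"])
        (auto simp: resolvent_power_norm_eq[OF Hk Tk] j simp del: blinfun_power.simps)
    with k show "z \<in> resolvent_set (Hk k) (Tk k) \<and> norm (resolvent_blinfun (Hk k) (Tk k) z) \<le> D"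
      by simp
  qed
  then have "z \<in> resolvent_set H T"
    by (rule resolvent_set_of_bounded_resolvents[OF H T Hk Tk \<mu> \<mu>k conv])
  with z show False by (simp add: spectrum_def)
qed

section \<open>Holomorphy and the maximum principle\<close>

context
  fixes H :: "'a::complex_hilbert_space set" and T :: "'a unbounded_op"
  assumes H: "closed_csubspace H" and T: "linear_operator_in H T"
begin

lemma open_resolvent_set: "open (resolvent_set H T)"
proof -
  have "\<forall>\<^sub>F z in nhds w. z \<in> resolvent_set H T" if w: "w \<in> resolvent_set H T" for w
    by (rule resolvent_tendsto(1)[OF H T H T w w tendsto_const w filterlim_ident])
  then show ?thesis
    by (intro iffD2[OF open_subopen] ballI) (simp only: eventually_nhds subset_eq)
qed

lemma resolvent_blinfun_tendsto:
  assumes w: "w \<in> resolvent_set H T"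
  shows "(resolvent_blinfun H T \<longlongrightarrow> resolvent_blinfun H T w) (at w)"
  by (rule resolvent_tendsto(2)[OF H T H T w w tendsto_const w tendsto_ident_at])

text \<open>By the resolvent identity the remainder is \<open>(z - w) R w (R z - R w)\<close>, which
  is of smaller order than \<open>z - w\<close> by continuity of the resolvent.\<close>

lemma has_derivative_resolvent:
  assumes w: "w \<in> resolvent_set H T"
  shows "(resolvent_blinfun H T has_derivative
    (\<lambda>h. blinfun_scaleC h o\<^sub>L (resolvent_blinfun H T w o\<^sub>L resolvent_blinfun H T w))) (at w)"
proof -
  define R where "R = resolvent_blinfun H T"
  have lin: "bounded_linear (\<lambda>h. blinfun_scaleC h o\<^sub>L (R w o\<^sub>L R w))"
    using bounded_linear_compose[OF bounded_bilinear.bounded_linear_left[OF bounded_bilinear_blinfun_compose]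
        bounded_linear_blinfun_scaleC] .
  have lim: "((\<lambda>z. norm (R z - R w)) \<longlongrightarrow> 0) (at w)"
    unfolding R_def by (intro tendsto_norm_zero LIM_zero resolvent_blinfun_tendsto w)
  have "\<forall>\<^sub>F z in at w. z \<in> resolvent_set H T \<and> z \<noteq> w"
    using eventually_at_in_open[OF open_resolvent_set w] by eventually_elim auto
  then have "\<forall>\<^sub>F z in at w. norm (norm (R z - R w - (blinfun_scaleC (z - w) o\<^sub>L (R w o\<^sub>L R w))) / norm (z - w))
      \<le> norm (norm (R z - R w)) * norm (R w)"
  proof eventually_elim
    case (elim z)
    have "R z - R w - (blinfun_scaleC (z - w) o\<^sub>L (R w o\<^sub>L R w)) =
        blinfun_scaleC (z - w) o\<^sub>L (R w o\<^sub>L (R z - R w))"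
    proof (rule blinfun_eqI)
      fix y
      have eq: "R z y - R w y = (z - w) *\<^sub>C R w (R z y)"
        using resolvent_identity[OF H T w, of z y] elim
        unfolding R_def by (metis add_diff_cancel_left')
      have "(R z - R w - (blinfun_scaleC (z - w) o\<^sub>L (R w o\<^sub>L R w))) y =
          (R z y - R w y) - (z - w) *\<^sub>C R w (R w y)"
        by (simp add: blinfun.diff_left)
      also have "\<dots> = (z - w) *\<^sub>C R w (R z y) - (z - w) *\<^sub>C R w (R w y)"
        by (simp only: eq)
      also have "\<dots> = (blinfun_scaleC (z - w) o\<^sub>L (R w o\<^sub>L (R z - R w))) y"
        by (simp add: blinfun.diff_left blinfun.diff_right scaleC.diff_right)
      finally show "(R z - R w - (blinfun_scaleC (z - w) o\<^sub>L (R w o\<^sub>L R w))) y =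
          (blinfun_scaleC (z - w) o\<^sub>L (R w o\<^sub>L (R z - R w))) y" .
    qed
    then have "norm (R z - R w - (blinfun_scaleC (z - w) o\<^sub>L (R w o\<^sub>L R w))) \<le>
        cmod (z - w) * (norm (R w) * norm (R z - R w))"
      by (simp only:)
        (rule order_trans[OF norm_blinfun_scaleC_compose_le mult_left_mono[OF norm_blinfun_compose norm_ge_zero]])
    with elim show ?case
      by (simp add: divide_le_eq mult_ac)
  qed
  from tendsto_0_le[OF lim this] show ?thesis
    unfolding has_derivative_iff_norm using lin by (simp add: R_def)
qed

text \<open>\<open>has_derivative\<close> is a real notion; the form \<open>h D\<close> of the
  derivative records complex differentiability. In the product rule, \<open>h\<close> is pulled
  through the resolvent by its complex homogeneity.\<close>

lemma has_derivative_resolvent_power: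
  assumes w: "w \<in> resolvent_set H T"
  shows "\<exists>D. ((\<lambda>z. blinfun_power (resolvent_blinfun H T z) m) has_derivative (\<lambda>h. blinfun_scaleC h o\<^sub>L D)) (at w)"
proof (induction m)
  case 0
  have "blinfun_scaleC h o\<^sub>L 0 = (0 :: 'a \<Rightarrow>\<^sub>L 'a)" for h
    by simp
  then show ?case
    by (auto intro!: exI[of _ 0])
next
  case (Suc m)
  define R where "R = resolvent_blinfun H T w"
  define P where "P = blinfun_power R m"
  from Suc obtain D where D: "((\<lambda>z. blinfun_power (resolvent_blinfun H T z) m) has_derivative
      (\<lambda>h. blinfun_scaleC h o\<^sub>L D)) (at w)"
    by blast
  have "(R o\<^sub>L (blinfun_scaleC h o\<^sub>L D)) + ((blinfun_scaleC h o\<^sub>L (R o\<^sub>L R)) o\<^sub>L P) =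
      blinfun_scaleC h o\<^sub>L ((R o\<^sub>L D) + (R o\<^sub>L (R o\<^sub>L P)))" for h
    by (rule blinfun_eqI)
      (simp add: blinfun.bilinear_simps scaleC_algebra R_def resolvent_blinfun_scaleC[OF H T w])
  with bounded_bilinear.FDERIV[OF bounded_bilinear_blinfun_compose has_derivative_resolvent[OF w] D]
  show ?case
    by (auto simp: R_def P_def)
qed

text \<open>The functional sending \<open>A\<close> to \<open>cinner (A x) y\<close> maps the
  derivative \<open>h D\<close> to \<open>h * cinner (D x) y\<close>, an ordinary complex
  derivative. These scalar functions are what the maximum principle works with.\<close>

lemma holomorphic_on_cinner_resolvent_power:
  assumes "S \<subseteq> resolvent_set H T"
  shows "(\<lambda>z. cinner (blinfun_power (resolvent_blinfun H T z) m x) y) holomorphic_on S"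
proof (rule holomorphic_onI)
  fix w assume "w \<in> S"
  with assms have "w \<in> resolvent_set H T" by blast
  from has_derivative_resolvent_power[OF this] obtain D where
    D: "((\<lambda>z. blinfun_power (resolvent_blinfun H T z) m) has_derivative (\<lambda>h. blinfun_scaleC h o\<^sub>L D)) (at w)"
    by blast
  have "bounded_linear (\<lambda>A :: 'a \<Rightarrow>\<^sub>L 'a. cinner (A x) y)"
    by (rule bounded_linear_compose[OF bounded_linear_cinner_left blinfun.bounded_linear_left])
  from bounded_linear.has_derivative[OF this D]
  have "((\<lambda>z. cinner (blinfun_power (resolvent_blinfun H T z) m x) y) has_field_derivative cinner (D x) y) (at w)"
    by (simp add: has_field_derivative_def cinner_scaleC_left mult_commute_abs)
  then show "(\<lambda>z. cinner (blinfun_power (resolvent_blinfun H T z) m x) y) field_differentiable (at w within S)"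
    using field_differentiable_at_within field_differentiable_def by blast
qed

end

text \<open>
  Schwarz's lemma for \<open>(g - g 0) / (1 - cnj (g 0) * g)\<close>: values of modulus close to 1 at the centre
  propagate to the whole disc.
\<close>

lemma Schwarz_Pick_diff_bound:
  assumes hol: "g holomorphic_on ball 0 1" and lt1: "\<And>z. norm z < 1 \<Longrightarrow> cmod (g z) < 1"
    and z: "norm z < 1"
  shows "(1 - norm z) * cmod (g z - g 0) \<le> 1 - (cmod (g 0))\<^sup>2"
proof -
  define a where "a = g 0"
  have a: "cmod a < 1" using lt1[of 0] by (simp add: a_def)
  define h where "h = Moebius_function 0 a \<circ> g"
  have "h holomorphic_on ball 0 1"
    unfolding h_def
    by (rule holomorphic_on_compose_gen[OF hol Moebius_function_holomorphic[OF a]]) (auto simp: lt1)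
  then have hz: "cmod (h z) \<le> norm z"
    by (rule Schwarz_Lemma) (auto simp: h_def a_def Moebius_function_eq_zero lt1 z
        intro!: Moebius_function_norm_lt_1)
  have "cmod (cnj a * g z) < 1"
    using a lt1[OF z] by (metis complex_mod_cnj norm_mult_less mult_1)
  then have ne: "1 - cnj a * g z \<noteq> 0" by auto
  have "g z - a = h z * (1 - cnj a * g z)"
    using ne by (simp add: h_def Moebius_function_simple)
  then have "cmod (g z - a) \<le> norm z * cmod (1 - cnj a * g z)"
    using hz by (simp add: norm_mult mult_right_mono)
  \<comment> \<open>In this form the right-hand side contains \<open>g z - a\<close> again, with a
    factor at most \<open>norm z\<close>, and the term is absorbed on the left.\<close>
  also have "1 - cnj a * g z = complex_of_real (1 - (cmod a)\<^sup>2) - cnj a * (g z - a)"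
    using complex_norm_square[of a] by (simp add: algebra_simps)
  also have "norm z * cmod \<dots> \<le> norm z * ((1 - (cmod a)\<^sup>2) + cmod (g z - a))"
  proof (intro mult_left_mono order_trans[OF norm_triangle_ineq4] add_mono)
    have "(cmod a)\<^sup>2 \<le> 1"
      using a by (simp add: power_le_one)
    then show "cmod (complex_of_real (1 - (cmod a)\<^sup>2)) \<le> 1 - (cmod a)\<^sup>2"
      by (simp only: norm_of_real)
    show "cmod (cnj a * (g z - a)) \<le> cmod (g z - a)"
      using a by (simp add: norm_mult mult_left_le_one_le)
  qed simp
  finally have "(1 - norm z) * cmod (g z - a) \<le> norm z * (1 - (cmod a)\<^sup>2)"
    by (simp add: algebra_simps)
  also have "\<dots> \<le> 1 - (cmod a)\<^sup>2"
    using z a by (intro mult_left_le_one_le) (auto simp: power_le_one)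
  finally show ?thesis by (simp add: a_def)
qed

text \<open>The operator norm need not be attained, so \<open>F\<close> is tested against vectors
  that nearly attain it at \<open>c\<close>. The resulting scalar functions have modulus near 1 at
  the centre, the Schwarz-Pick bound keeps them near 1 at \<open>z\<close>, and the approximation
  parameter \<open>t\<close> then tends to 1.\<close>

lemma norm_blinfun_maximum_principle:
  fixes F :: "complex \<Rightarrow> 'a::complex_hilbert_space \<Rightarrow>\<^sub>L 'a"
  assumes hol: "\<And>x y. (\<lambda>z. cinner (F z x) y) holomorphic_on ball c r"
    and max: "\<And>z. z \<in> ball c r \<Longrightarrow> norm (F z) \<le> norm (F c)"
    and z: "z \<in> ball c r"
  shows "norm (F z) = norm (F c)"
proof (cases "norm (F c) = 0")
  case True
  then show ?thesis using max[OF z] by simp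
next
  case False
  define M where "M = norm (F c)"
  have M: "M > 0" using False by (simp add: M_def)
  have r: "r > 0" using z by (metis dist_not_less_zero le_less_trans linorder_not_less mem_ball not_le)
  define u where "u = (z - c) / of_real r"
  have u: "norm u < 1" and zu: "z = c + of_real r * u"
    using z r by (auto simp: u_def norm_divide dist_norm norm_minus_commute)
  have bound: "t\<^sup>2 - (1 - t ^ 4) / (1 - norm u) \<le> norm (F z) / M" if t: "0 < t" "t < 1" for t
  proof -
    obtain x where x: "norm (F c x) > t * M * norm x"
    proof (rule ccontr)
      assume "\<not> thesis"
      then have "norm (F c x) \<le> t * M * norm x" for x
        using that not_le by blast
      then have "M \<le> t * M"
        unfolding M_def using t by (intro norm_blinfun_bound) auto
      then show False using M t by simp
    qed
    define y where "y = F c x"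
    have y0: "norm y > 0"
      using x t M unfolding y_def by (meson le_less_trans mult_nonneg_nonneg norm_ge_zero less_imp_le)
    then have x0: "norm x > 0" by (auto simp: y_def)
    \<comment> \<open>Scaling by \<open>1 / (M * norm x * norm y)\<close> gives modulus at most 1;
      the additional factor \<open>t\<close> makes it strictly less than 1 and still leaves at least
      \<open>t\<^sup>2\<close> at the centre.\<close>
    define s where "s = t / (M * norm x * norm y)"
    have s: "s > 0" using t M x0 y0 by (simp add: s_def)
    define g where "g v = of_real s * cinner (F (c + of_real r * v) x) y" for v
    have mem: "c + of_real r * v \<in> ball c r" if "norm v < 1" for v
      using that r by (simp add: dist_norm norm_mult)
    have g_le: "cmod (g v) \<le> t * (norm (F (c + of_real r * v)) / M)" for v
    proof -
      have "cmod (cinner (F (c + of_real r * v) x) y) \<le> norm (F (c + of_real r * v)) * norm x * norm y"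
        by (rule order_trans[OF cmod_cinner_le mult_right_mono[OF norm_blinfun norm_ge_zero]])
      then have "cmod (g v) \<le> s * (norm (F (c + of_real r * v)) * norm x * norm y)"
        unfolding g_def using s by (simp add: norm_mult del: mult_le_cancel_left_pos)
      also have "\<dots> = t * (norm (F (c + of_real r * v)) / M)"
        using x0 y0 M by (simp add: s_def field_simps)
      finally show ?thesis .
    qed
    have g_lt: "cmod (g v) < 1" if "norm v < 1" for v
    proof -
      have "t * (norm (F (c + of_real r * v)) / M) \<le> t * 1"
        using max[OF mem[OF that]] M t by (intro mult_left_mono) (auto simp: M_def)
      then show ?thesis using g_le[of v] t by simp
    qed
    have "(\<lambda>z. cinner (F z x) y) \<circ> (\<lambda>v. c + of_real r * v) holomorphic_on ball 0 1"
      by (rule holomorphic_on_compose_gen[OF _ hol]) (auto intro!: holomorphic_intros mem)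
    then have g_hol: "g holomorphic_on ball 0 1"
      unfolding g_def by (intro holomorphic_intros) (simp add: o_def)
    have "cmod (g 0) = s * (norm y)\<^sup>2"
      using s by (simp add: g_def norm_mult cinner_self norm_power flip: y_def)
    also have "\<dots> = t * (norm y / (M * norm x))"
      using y0 by (simp add: s_def power2_eq_square)
    finally have g0: "cmod (g 0) = t * (norm y / (M * norm x))" .
    have "t * t \<le> t * (norm y / (M * norm x))"
      using x t M x0 by (intro mult_left_mono) (auto simp: le_divide_eq y_def mult_ac)
    then have t2: "t\<^sup>2 \<le> cmod (g 0)"
      by (simp add: g0 power2_eq_square)
    have "(1 - norm u) * cmod (g u - g 0) \<le> 1 - (cmod (g 0))\<^sup>2"
      by (rule Schwarz_Pick_diff_bound[OF g_hol g_lt u])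
    also have "\<dots> \<le> 1 - t ^ 4"
      using power_mono[OF t2, of 2] t by (simp flip: power_mult)
    finally have "cmod (g u - g 0) \<le> (1 - t ^ 4) / (1 - norm u)"
      using u by (simp add: le_divide_eq mult.commute)
    moreover have "cmod (g 0) \<le> cmod (g u) + cmod (g u - g 0)"
      by (metis norm_minus_commute norm_triangle_sub add.commute)
    moreover have "cmod (g u) \<le> norm (F z) / M"
      using g_le[of u] t M mult_right_mono[of t 1 "norm (F z) / M"] by (simp flip: zu)
    ultimately show ?thesis using t2 by linarith
  qed
  \<comment> \<open>As \<open>t\<close> tends to 1 from the left, the Schwarz-Pick error vanishes
    and the lower bound becomes 1.\<close>
  have "((\<lambda>t. t\<^sup>2 - (1 - t ^ 4) / (1 - norm u)) \<longlongrightarrow> 1\<^sup>2 - (1 - 1 ^ 4) / (1 - norm u)) (at_left (1::real))"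
    using u by (intro tendsto_intros) auto
  then have "1\<^sup>2 - (1 - 1 ^ 4) / (1 - norm u) \<le> norm (F z) / M"
  proof (rule tendsto_upperbound)
    show "\<forall>\<^sub>F t in at_left 1. t\<^sup>2 - (1 - t ^ 4) / (1 - norm u) \<le> norm (F z) / M"
      unfolding eventually_at_left_field using bound by (intro exI[of _ 0]) auto
  qed simp
  then have "norm (F c) \<le> norm (F z)"
    using M by (simp add: M_def le_divide_eq)
  with max[OF z] show ?thesis by simp
qed

section \<open>Convergence of pseudospectra\<close>

text \<open>Raising to the power \<open>2 ^ n\<close> is strictly monotone on nonnegative reals and
  removes the root. Points of the spectrum satisfy the implication vacuously, in line with the
  infinite norm there.\<close>

lemma mem_pseudospectrum_iff:
  assumes H: "closed_csubspace H" and T: "linear_operator_in H T" and "\<epsilon> > 0"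
  shows "z \<in> pseudospectrum n \<epsilon> H T \<longleftrightarrow>
    (z \<in> resolvent_set H T \<longrightarrow> (1 / \<epsilon>) ^ 2 ^ n < resolvent_power_norm n H T z)"
proof (cases "z \<in> resolvent_set H T")
  case True
  define x where "x = resolvent_power_norm n H T z"
  define b where "b = (1 / \<epsilon>) ^ 2 ^ n"
  have x: "x \<ge> 0" and b: "b \<ge> 0"
    using \<open>\<epsilon> > 0\<close> by (simp_all add: x_def b_def resolvent_power_norm_eq[OF H T True])
  have b_eq: "1 / \<epsilon> = b powr (1 / 2 ^ n)"
    using \<open>\<epsilon> > 0\<close> by (simp add: b_def powr_powr flip: powr_realpow)
  have "b powr (1 / 2 ^ n) < x powr (1 / 2 ^ n) \<longleftrightarrow> b < x"
    using powr_less_mono2[of "1 / 2 ^ n" b x] powr_mono2[of "1 / 2 ^ n" x b] x b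
    by (auto simp: not_less[symmetric])
  with True show ?thesis
    by (simp add: pseudospectrum_def spectrum_def flip: x_def b_def b_eq)
qed (simp add: pseudospectrum_def spectrum_def)

text \<open>In the resolvent set the defining inequality is strict, hence stable under convergence
  of the resolvent powers; on the spectrum the norms eventually exceed every constant.\<close>

lemma eventually_mem_pseudospectrum:
  assumes H: "closed_csubspace H" and T: "linear_operator_in H T"
    and Hk: "\<And>k. closed_csubspace (Hk k)" and Tk: "\<And>k. linear_operator_in (Hk k) (Tk k)"
    and \<mu>: "\<mu> \<in> resolvent_set H T" and \<mu>k: "\<And>k. \<mu> \<in> resolvent_set (Hk k) (Tk k)"
    and conv: "((\<lambda>k. resolvent_blinfun (Hk k) (Tk k) \<mu>) \<longlongrightarrow> resolvent_blinfun H T \<mu>) F"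
    and "\<epsilon> > 0" and z: "z \<in> pseudospectrum n \<epsilon> H T"
  shows "\<forall>\<^sub>F k in F. z \<in> pseudospectrum n \<epsilon> (Hk k) (Tk k)"
proof (cases "z \<in> resolvent_set H T")
  case True
  note lim = resolvent_tendsto[OF H T Hk Tk \<mu> \<mu>k conv True tendsto_const]
  have "(1 / \<epsilon>) ^ 2 ^ n < norm (blinfun_power (resolvent_blinfun H T z) (2 ^ n))"
    using z True by (simp add: mem_pseudospectrum_iff[OF H T \<open>\<epsilon> > 0\<close>] resolvent_power_norm_eq[OF H T])
  with order_tendstoD(1)[OF tendsto_norm[OF tendsto_blinfun_power[OF lim(2)]]]
  have "\<forall>\<^sub>F k in F. (1 / \<epsilon>) ^ 2 ^ n < norm (blinfun_power (resolvent_blinfun (Hk k) (Tk k) z) (2 ^ n))"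
    by blast
  then show ?thesis
    by eventually_elim
      (simp add: mem_pseudospectrum_iff[OF Hk Tk \<open>\<epsilon> > 0\<close>] resolvent_power_norm_eq[OF Hk Tk])
next
  case False
  then show ?thesis
    using resolvent_power_norm_unbounded[OF H T Hk Tk \<mu> \<mu>k conv]
    by (simp add: mem_pseudospectrum_iff[OF Hk Tk \<open>\<epsilon> > 0\<close>] spectrum_def)
qed

lemma limit_mem_closure_pseudospectrum:
  assumes H: "closed_csubspace H" and T: "linear_operator_in H T"
    and Hk: "\<And>k. closed_csubspace (Hk k)" and Tk: "\<And>k. linear_operator_in (Hk k) (Tk k)"
    and \<mu>: "\<mu> \<in> resolvent_set H T" and \<mu>k: "\<And>k. \<mu> \<in> resolvent_set (Hk k) (Tk k)"
    and conv: "(\<lambda>k. resolvent_blinfun (Hk k) (Tk k) \<mu>) \<longlonglongrightarrow> resolvent_blinfun H T \<mu>"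
    and "\<epsilon> > 0"
    and nonconst: "\<And>U. open U \<Longrightarrow> U \<noteq> {} \<Longrightarrow> U \<subseteq> resolvent_set H T \<Longrightarrow>
           \<not> (\<lambda>z. resolvent_power_norm n H T z) constant_on U"
    and \<zeta>: "\<And>k. \<zeta> k \<in> closure (pseudospectrum n \<epsilon> (Hk k) (Tk k))" and "\<zeta> \<longlonglongrightarrow> z"
  shows "z \<in> closure (pseudospectrum n \<epsilon> H T)"
proof (rule ccontr)
  assume "z \<notin> closure (pseudospectrum n \<epsilon> H T)"
  then obtain r where r: "r > 0" and "ball z r \<inter> closure (pseudospectrum n \<epsilon> H T) = {}"
    by (meson closed_closure open_Compl open_contains_ball ComplI disjoint_eq_subset_Compl)
  then have disj: "v \<notin> pseudospectrum n \<epsilon> H T" if "v \<in> ball z r" for v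
    using closure_subset that by blast
  define b where "b = (1 / \<epsilon>) ^ 2 ^ n"
  have ball: "ball z r \<subseteq> resolvent_set H T"
    using disj mem_pseudospectrum_iff[OF H T \<open>\<epsilon> > 0\<close>] by blast
  define F where "F v = blinfun_power (resolvent_blinfun H T v) (2 ^ n)" for v
  have le: "norm (F v) \<le> b" if "v \<in> ball z r" for v
    using disj[OF that] ball that
    by (auto simp: mem_pseudospectrum_iff[OF H T \<open>\<epsilon> > 0\<close>] resolvent_power_norm_eq[OF H T] F_def b_def)
  have z: "z \<in> resolvent_set H T"
    using ball r by auto
  \<comment> \<open>The points of the closures are replaced by nearby points of the pseudospectra
    themselves, with the same limit, because the strict inequality is known only there.\<close>
  have "\<exists>\<omega>\<in>pseudospectrum n \<epsilon> (Hk k) (Tk k). dist \<omega> (\<zeta> k) < 1 / Suc k" for k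
    using \<zeta>[of k] by (simp only: closure_approachable) simp
  then obtain \<omega> where \<omega>: "\<And>k. \<omega> k \<in> pseudospectrum n \<epsilon> (Hk k) (Tk k)"
    and dist: "\<And>k. dist (\<omega> k) (\<zeta> k) < 1 / Suc k"
    by metis
  have "(\<lambda>k. dist (\<omega> k) (\<zeta> k)) \<longlonglongrightarrow> 0"
    by (rule tendsto_sandwich[OF _ _ tendsto_const LIMSEQ_Suc[OF lim_1_over_n]])
      (use dist in \<open>auto intro!: always_eventually less_imp_le simp del: of_nat_Suc\<close>)
  then have "(\<lambda>k. \<omega> k - \<zeta> k) \<longlonglongrightarrow> 0"
    unfolding dist_norm by (rule tendsto_norm_zero_cancel)
  with \<open>\<zeta> \<longlonglongrightarrow> z\<close> have "\<omega> \<longlonglongrightarrow> z"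
    by (rule Lim_transform)
  note lim = resolvent_tendsto[OF H T Hk Tk \<mu> \<mu>k conv z this]
  \<comment> \<open>The strict inequalities at \<open>\<omega> k\<close> pass to the limit as a weak
    one. Since \<open>norm (F v) \<le> b\<close> on the ball, its maximum is attained at the
    centre.\<close>
  have "b \<le> norm (F z)"
    unfolding F_def
  proof (rule tendsto_lowerbound[OF tendsto_norm[OF tendsto_blinfun_power[OF lim(2)]]])
    show "\<forall>\<^sub>F k in sequentially. b \<le> norm (blinfun_power (resolvent_blinfun (Hk k) (Tk k) (\<omega> k)) (2 ^ n))"
      using lim(1) by eventually_elim
        (use \<omega> in \<open>simp add: mem_pseudospectrum_iff[OF Hk Tk \<open>\<epsilon> > 0\<close>] resolvent_power_norm_eq[OF Hk Tk]
          b_def less_imp_le\<close>)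
  qed simp
  then have "norm (F v) \<le> norm (F z)" if "v \<in> ball z r" for v
    using le[OF that] by simp
  then have "norm (F v) = norm (F z)" if "v \<in> ball z r" for v
    using norm_blinfun_maximum_principle[of F z r v, OF _ _ that]
      holomorphic_on_cinner_resolvent_power[OF H T ball] by (simp add: F_def)
  then have "(\<lambda>z. resolvent_power_norm n H T z) constant_on ball z r"
    unfolding constant_on_def F_def using ball
    by (intro exI[of _ "norm (F z)"]) (auto simp: resolvent_power_norm_eq[OF H T] F_def)
  moreover have "ball z r \<noteq> {}" using r by simp
  ultimately show False
    using nonconst[OF open_ball _ ball] by blast
qed

text \<open>Each half of the distance uses compactness once: a finite cover makes
  \<open>lower\<close> uniform, and a convergent subsequence reduces the other half to
  \<open>upper\<close>.\<close>

lemma hausdorff_dist_tendsto_0: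
  fixes A K :: "complex set" and Ak :: "nat \<Rightarrow> complex set"
  assumes "compact K" and eq: "closure A \<inter> K = closure (A \<inter> K)" and ne: "closure (A \<inter> K) \<noteq> {}"
    and lower: "\<And>z. z \<in> A \<Longrightarrow> \<forall>\<^sub>F k in sequentially. z \<in> Ak k"
    and upper: "\<And>s \<zeta> z. strict_mono s \<Longrightarrow> (\<And>j. \<zeta> j \<in> closure (Ak (s j))) \<Longrightarrow> \<zeta> \<longlonglongrightarrow> z \<Longrightarrow>
      z \<in> closure A"
  shows "\<forall>\<^sub>F k in sequentially. closure (Ak k) \<inter> K \<noteq> {}"
    and "(\<lambda>k. hausdorff_dist (closure (Ak k) \<inter> K) (closure A \<inter> K)) \<longlonglongrightarrow> 0"
proof -
  define L where "L = closure A \<inter> K"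
  have L_ne: "L \<noteq> {}" and L_eq: "L = closure (A \<inter> K)"
    using eq ne by (auto simp: L_def)
  have L: "compact L"
    unfolding L_def by (simp add: closed_Int_compact \<open>compact K\<close>)
  obtain p where "p \<in> A" "p \<in> K"
    using ne by auto
  show nonempty: "\<forall>\<^sub>F k in sequentially. closure (Ak k) \<inter> K \<noteq> {}"
    using lower[OF \<open>p \<in> A\<close>] by eventually_elim (use \<open>p \<in> K\<close> closure_subset in blast)
  \<comment> \<open>The identity \<open>L = closure (A \<inter> K)\<close> allows the covering balls
    to be centred in \<open>A \<inter> K\<close>. Their finitely many centres eventually lie in
    \<open>Ak k\<close>, and also in \<open>K\<close>.\<close>
  have near1: "\<forall>\<^sub>F k in sequentially. \<forall>z\<in>L. infdist z (closure (Ak k) \<inter> K) \<le> e" if "e > 0" for e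
  proof -
    have "L \<subseteq> (\<Union>p\<in>A \<inter> K. ball p e)"
    proof
      fix z assume "z \<in> L"
      then obtain p where "p \<in> A \<inter> K" "dist p z < e"
        using \<open>e > 0\<close> unfolding L_eq closure_approachable by blast
      then show "z \<in> (\<Union>p\<in>A \<inter> K. ball p e)" by auto
    qed
    from compactE_image[OF L open_ball this] obtain C where
      C: "C \<subseteq> A \<inter> K" "finite C" "L \<subseteq> (\<Union>p\<in>C. ball p e)" .
    have "\<forall>\<^sub>F k in sequentially. \<forall>p\<in>C. p \<in> Ak k"
      using C lower by (intro eventually_ball_finite) auto
    then show ?thesis
    proof eventually_elim
      case (elim k)
      show ?case
      proof
        fix z assume "z \<in> L"
        then obtain p where "p \<in> C" "dist p z < e"
          using C by auto
        moreover from this have "p \<in> closure (Ak k) \<inter> K"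
          using elim C closure_subset by blast
        ultimately show "infdist z (closure (Ak k) \<inter> K) \<le> e"
          using infdist_le2[of p "closure (Ak k) \<inter> K" z e] by (simp add: dist_commute)
      qed
    qed
  qed
  \<comment> \<open>Points of \<open>K\<close> in the closures of \<open>Ak (s j)\<close> that stay
    farther than \<open>e\<close> from \<open>L\<close> would accumulate at a point of
    \<open>closure A \<inter> K\<close>, that is, of \<open>L\<close> itself.\<close>
  have near2: "\<forall>\<^sub>F k in sequentially. \<forall>z\<in>closure (Ak k) \<inter> K. infdist z L \<le> e" if "e > 0" for e
  proof (rule ccontr)
    assume "\<not> ?thesis"
    from not_eventually_sequentiallyD[OF this] obtain s :: "nat \<Rightarrow> nat" where s: "strict_mono s"
      and "\<And>j. \<exists>z\<in>closure (Ak (s j)) \<inter> K. e < infdist z L"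
      by (auto simp: not_le)
    then obtain \<zeta> where \<zeta>: "\<And>j. \<zeta> j \<in> closure (Ak (s j))" "\<And>j. \<zeta> j \<in> K" and far: "\<And>j. e < infdist (\<zeta> j) L"
      by (metis IntE)
    from \<open>compact K\<close> \<zeta>(2) obtain l t where l: "l \<in> K" and t: "strict_mono t" and lim: "(\<zeta> \<circ> t) \<longlonglongrightarrow> l"
      unfolding compact_def by metis
    have "l \<in> closure A"
      by (rule upper[OF strict_mono_o[OF s t] _ lim]) (simp add: \<zeta>)
    with l have "infdist l L = 0"
      by (simp add: L_def)
    moreover have "e \<le> infdist l L"
      by (rule tendsto_lowerbound[OF tendsto_infdist[OF lim]])
        (use far in \<open>auto intro!: always_eventually less_imp_le\<close>)
    ultimately show False using \<open>e > 0\<close> by simp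
  qed
  show "(\<lambda>k. hausdorff_dist (closure (Ak k) \<inter> K) (closure A \<inter> K)) \<longlonglongrightarrow> 0"
  proof (rule tendstoI)
    fix e :: real assume "e > 0"
    then have "e / 2 > 0" by simp
    from nonempty near1[OF this] near2[OF this]
    show "\<forall>\<^sub>F k in sequentially. dist (hausdorff_dist (closure (Ak k) \<inter> K) (closure A \<inter> K)) 0 < e"
    proof eventually_elim
      case (elim k)
      define M where "M = closure (Ak k) \<inter> K"
      have "(SUP z\<in>M. infdist z L) \<le> e / 2" "(SUP z\<in>L. infdist z M) \<le> e / 2"
        using elim L_ne unfolding M_def by (blast intro: cSUP_least)+
      \<comment> \<open>One nonnegative supremum makes the maximum nonnegative, so its distance to 0
        is its value; boundedness of the supremum comes from \<open>near2\<close>.\<close>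
      moreover have "0 \<le> (SUP z\<in>M. infdist z L)"
      proof -
        obtain z where "z \<in> M" using elim by (auto simp: M_def)
        then show ?thesis
          using elim by (intro cSUP_upper2[where x = z] bdd_aboveI2[where M = "e / 2"]) (auto simp: M_def infdist_nonneg)
      qed
      ultimately show ?case
        using \<open>e > 0\<close> by (simp add: hausdorff_dist_def flip: M_def L_def)
    qed
  qed
qed

theorem theorem2p5:
  fixes n :: nat
    and H :: "'a::complex_hilbert_space set" and Hk :: "nat \<Rightarrow> 'a set"
    and T :: "'a unbounded_op" and Tk :: "nat \<Rightarrow> 'a unbounded_op"
    and K :: "complex set" and \<epsilon> :: real
  assumes "closed_csubspace H" and "\<And>k. closed_csubspace (Hk k)"
    and "linear_operator_in H T" and "closed_operator T" and "densely_defined_in H T"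
    and "\<And>k. linear_operator_in (Hk k) (Tk k)" and "\<And>k. closed_operator (Tk k)"
    and "\<And>k. densely_defined_in (Hk k) (Tk k)"
    and "(\<Inter>k. resolvent_set (Hk k) (Tk k)) \<inter> resolvent_set H T \<noteq> {}"
    and "compact K" and "\<epsilon> > 0"
    and "closure (pseudospectrum n \<epsilon> H T) \<inter> K = closure (pseudospectrum n \<epsilon> H T \<inter> K)"
    and "closure (pseudospectrum n \<epsilon> H T \<inter> K) \<noteq> {}"
    and "\<And>U. open U \<Longrightarrow> U \<noteq> {} \<Longrightarrow> U \<subseteq> resolvent_set H T \<Longrightarrow>
           \<not> (\<lambda>z. resolvent_power_norm n H T z) constant_on U"
    and "gen_norm_resolvent_conv Hk Tk H T"
  shows "(\<forall>\<^sub>F k in sequentially. closure (pseudospectrum n \<epsilon> (Hk k) (Tk k)) \<inter> K \<noteq> {}) \<and>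
         (\<lambda>k. hausdorff_dist (closure (pseudospectrum n \<epsilon> (Hk k) (Tk k)) \<inter> K)
                              (closure (pseudospectrum n \<epsilon> H T) \<inter> K)) \<longlonglongrightarrow> 0"
proof -
  note H = assms(1) and Hk = assms(2) and T = assms(3) and Tk = assms(6) and eps = assms(11)
  obtain \<mu> where \<mu>: "\<mu> \<in> resolvent_set H T" and \<mu>k: "\<And>k. \<mu> \<in> resolvent_set (Hk k) (Tk k)"
    and lim: "(\<lambda>k. onorm (\<lambda>x. resolvent (Tk k) \<mu> (orth_proj (Hk k) x) - resolvent T \<mu> (orth_proj H x)))
         \<longlonglongrightarrow> 0"
    using assms(15) by (auto simp: gen_norm_resolvent_conv_def)
  \<comment> \<open>The convergence hypothesis is thereby norm convergence of the extended
    resolvents.\<close>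
  have "blinfun_apply (resolvent_blinfun (Hk k) (Tk k) \<mu> - resolvent_blinfun H T \<mu>) =
      (\<lambda>x. resolvent (Tk k) \<mu> (orth_proj (Hk k) x) - resolvent T \<mu> (orth_proj H x))" for k
    by (rule ext)
      (simp only: blinfun.diff_left resolvent_blinfun_apply[OF H T \<mu>] resolvent_blinfun_apply[OF Hk Tk \<mu>k])
  then have "onorm (\<lambda>x. resolvent (Tk k) \<mu> (orth_proj (Hk k) x) - resolvent T \<mu> (orth_proj H x)) =
      norm (resolvent_blinfun (Hk k) (Tk k) \<mu> - resolvent_blinfun H T \<mu>)" for k
    by (simp only: norm_blinfun.rep_eq)
  with lim have conv: "(\<lambda>k. resolvent_blinfun (Hk k) (Tk k) \<mu>) \<longlonglongrightarrow> resolvent_blinfun H T \<mu>"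
    by (auto intro: LIM_zero_cancel[OF tendsto_norm_zero_cancel])
  \<comment> \<open>Convergence at \<open>\<mu>\<close> passes to the families along the subsequence
    \<open>s\<close>, to which the limit lemma is applied.\<close>
  have upper: "z \<in> closure (pseudospectrum n \<epsilon> H T)"
    if s: "strict_mono s" and \<zeta>: "\<And>j. \<zeta> j \<in> closure (pseudospectrum n \<epsilon> (Hk (s j)) (Tk (s j)))"
      and "\<zeta> \<longlonglongrightarrow> z" for s \<zeta> z
    by (rule limit_mem_closure_pseudospectrum[OF H T Hk Tk \<mu> \<mu>k _ eps assms(14) \<zeta> \<open>\<zeta> \<longlonglongrightarrow> z\<close>])
      (use LIMSEQ_subseq_LIMSEQ[OF conv s] in \<open>auto simp: o_def\<close>)
  note lower = eventually_mem_pseudospectrum[OF H T Hk Tk \<mu> \<mu>k conv eps]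
  show ?thesis
    by (intro conjI hausdorff_dist_tendsto_0[OF assms(10,12,13) lower upper])
qed

end
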